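(* For each integer $t\ge1$ let $G_t$ be the complete graph on the vertex set $\{a,b,c,d\}$ with six independent edge weights, in which the two disjoint edges $ab$ and $cd$ have weights with distribution function $x\mapsto x^t$ on $[0,1]$ (the law of the maximum of $t$ independent uniform variables on $[0,1]$) and the four remaining edges have weights uniform on $[0,1]$. Let $T$ be the almost surely unique minimum spanning tree, and put $$R(t)=\frac{\mathbf{P}(ab\in T,\ cd\in T)}{\mathbf{P}(ab\in T)\,\mathbf{P}(cd\in T)}.$$ Then $$R(t)=\frac{2(5t+6)(t+1)(t+4)^2(2t+3)}{9\,(5t^2+12t+8)^2},\qquad R(t)=\frac{4t}{45}+\frac{46}{75}+O(t^{-1})\quad(t\to\infty),$$ and $R(t)$ is strictly increasing on the positive integers, first exceeding $8$ at $t=84$. In particular $R(t)\to\infty$, so there is no constant $C$ such that $\mathbf{P}(e,f\in T)\le C\,\mathbf{P}(e\in T)\,\mathbf{P}(f\in T)$ holds for every finite connected graph, every choice of independent (not necessarily identically distributed) atomless edge weights, and every pair of distinct edges $e,f$, where $T$ is the minimum spanning tree.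
   Context: With independent atomless weights all edge weights are almost surely distinct, so the minimum spanning tree is almost surely unique. *)

theory Defs
  imports "HOL-Probability.Probability"
begin

text \<open>
  A finite simple graph is a finite vertex set \<open>V\<close> together with a set \<open>E\<close> of two-element
  subsets of \<open>V\<close>. The notion \<open>spanning_tree\<close> from \<open>Graph_Theory\<close> is not used, because there
  only directed cycles are excluded.
\<close>

definition simple_graph :: "'v set \<Rightarrow> 'v set set \<Rightarrow> bool" where
  "simple_graph V E \<longleftrightarrow> finite V \<and> (\<forall>e\<in>E. e \<subseteq> V \<and> card e = 2)"

definition graph_connected :: "'v set \<Rightarrow> 'v set set \<Rightarrow> bool" where
  "graph_connected V E \<longleftrightarrow>
     V \<noteq> {} \<and> (\<forall>u\<in>V. \<forall>v\<in>V. (u, v) \<in> {(x, y). {x, y} \<in> E}\<^sup>*)"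

definition is_cycle :: "'v set set \<Rightarrow> 'v list \<Rightarrow> bool" where
  "is_cycle E xs \<longleftrightarrow> 3 \<le> length xs \<and> distinct xs \<and>
     (\<forall>i<length xs. {xs ! i, xs ! (Suc i mod length xs)} \<in> E)"

definition spanning_tree :: "'v set \<Rightarrow> 'v set set \<Rightarrow> 'v set set \<Rightarrow> bool" where
  "spanning_tree V E T \<longleftrightarrow> T \<subseteq> E \<and> graph_connected V T \<and> (\<nexists>xs. is_cycle T xs)"

definition is_mst :: "'v set \<Rightarrow> 'v set set \<Rightarrow> ('v set \<Rightarrow> real) \<Rightarrow> 'v set set \<Rightarrow> bool" where
  "is_mst V E c T \<longleftrightarrow> spanning_tree V E T \<and>
     (\<forall>T'. spanning_tree V E T' \<longrightarrow> (\<Sum>e\<in>T. c e) \<le> (\<Sum>e\<in>T'. c e))"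

text \<open>
  For random weights, \<open>mst\<close> is unspecified where the minimizer is not unique. Under independent
  atomless weights this happens only on a null set.
\<close>

definition mst :: "'v set \<Rightarrow> 'v set set \<Rightarrow> ('v set \<Rightarrow> real) \<Rightarrow> 'v set set" where
  "mst V E c = (THE T. is_mst V E c T)"

text \<open>
  Random edge weights are a family \<open>w\<close> of random variables on a probability space \<open>M\<close>, so
  \<open>\<lambda>e. w e \<omega>\<close> is the weight function at the sample point \<open>\<omega>\<close>.
\<close>

definition indep_edge_weights ::
    "'w measure \<Rightarrow> 'v set set \<Rightarrow> ('v set \<Rightarrow> 'w \<Rightarrow> real) \<Rightarrow> bool" where
  "indep_edge_weights M E w \<longleftrightarrow> prob_space M \<and> prob_space.indep_vars M (\<lambda>_. borel) w E"

definition atomless_edge_weights ::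
    "'w measure \<Rightarrow> 'v set set \<Rightarrow> ('v set \<Rightarrow> 'w \<Rightarrow> real) \<Rightarrow> bool" where
  "atomless_edge_weights M E w \<longleftrightarrow> (\<forall>e\<in>E. \<forall>x. measure (distr M borel (w e)) {x} = 0)"

definition mst_ratio ::
    "'v set \<Rightarrow> 'v set set \<Rightarrow> 'w measure \<Rightarrow> ('v set \<Rightarrow> 'w \<Rightarrow> real) \<Rightarrow> 'v set \<Rightarrow> 'v set \<Rightarrow> real" where
  "mst_ratio V E M w e f =
     (let T = (\<lambda>\<omega>. mst V E (\<lambda>e'. w e' \<omega>)) in
      \<P>(\<omega> in M. e \<in> T \<omega> \<and> f \<in> T \<omega>) / (\<P>(\<omega> in M. e \<in> T \<omega>) * \<P>(\<omega> in M. f \<in> T \<omega>)))"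

text \<open>The vertices \<open>a, b, c, d\<close> are the numbers \<open>0, 1, 2, 3\<close>.\<close>

definition K4_V :: "nat set" where
  "K4_V = {0, 1, 2, 3}"

definition K4_E :: "nat set set" where
  "K4_E = {e. e \<subseteq> K4_V \<and> card e = 2}"

definition ab :: "nat set" where "ab = {0, 1}"
definition cd :: "nat set" where "cd = {2, 3}"

definition unif01 :: "real measure" where
  "unif01 = uniform_measure lborel {0..1}"

text \<open>
  For \<open>t \<ge> 1\<close> the values \<open>x ^ t\<close> on \<open>[0, 1]\<close> (\<open>0\<close> at \<open>0\<close> and \<open>1\<close> at \<open>1\<close>) determine the
  distribution function on the whole line.
\<close>

definition K4_weights :: "nat \<Rightarrow> 'w measure \<Rightarrow> (nat set \<Rightarrow> 'w \<Rightarrow> real) \<Rightarrow> bool" where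
  "K4_weights t M w \<longleftrightarrow> indep_edge_weights M K4_E w \<and>
     (\<forall>e\<in>{ab, cd}. \<forall>x\<in>{0..1}. cdf (distr M borel (w e)) x = x ^ t) \<and>
     (\<forall>e\<in>K4_E - {ab, cd}. distr M borel (w e) = unif01)"

text \<open>
  The canonical realization: the coordinates on the product of the six laws. The law of the two
  distinguished weights is the Lebesgue--Stieltjes measure of the distribution function.
\<close>

definition power_law :: "nat \<Rightarrow> real measure" where
  "power_law t = interval_measure (\<lambda>x. (max 0 (min 1 x)) ^ t)"

definition K4_space :: "nat \<Rightarrow> (nat set \<Rightarrow> real) measure" where
  "K4_space t = PiM K4_E (\<lambda>e. if e \<in> {ab, cd} then power_law t else unif01)"

definition R :: "nat \<Rightarrow> real" where
  "R t = mst_ratio K4_V K4_E (K4_space t) (\<lambda>e \<omega>. \<omega> e) ab cd"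

end

theory Submission
  imports Defs "HOL-Real_Asymp.Real_Asymp"
begin

text \<open>
  If all weights are distinct, an edge \<open>uv\<close> lies in the minimum spanning tree iff \<open>u\<close> and \<open>v\<close> are
  not joined by a path of strictly lighter edges. In \<open>K\<^sub>4\<close> this turns \<open>ab \<in> T\<close> and \<open>cd \<in> T\<close> into
  comparisons of the four uniform weights with \<open>x = w(ab)\<close> and \<open>z = w(cd)\<close>. Given \<open>x\<close> and \<open>z\<close>, the
  event \<open>ab \<in> T\<close> has probability \<open>(1 - x\<^sup>2)\<^sup>2\<close> if \<open>x < z\<close> and \<open>1 - (1 - (1 - x)\<^sup>2)\<^sup>2\<close> if \<open>z < x\<close>, and for
  \<open>z < x\<close> both edges lie in \<open>T\<close> with probability \<open>2 (1 - x)\<^sup>2 (1 - z\<^sup>2) - (1 - x)\<^sup>4\<close>. Integrating these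
  polynomials against the density \<open>t x\<^sup>t\<^sup>-\<^sup>1\<close> gives the rational function \<open>R(t)\<close>, which grows
  linearly because \<open>ab\<close> and \<open>cd\<close> are both in \<open>T\<close> with probability of order \<open>t\<^sup>-\<^sup>3\<close> while each of
  them is in \<open>T\<close> with probability of order \<open>t\<^sup>-\<^sup>2\<close>.
\<close>

subsection \<open>Minimum spanning trees and lighter paths\<close>

abbreviation adj :: "'v set set \<Rightarrow> ('v \<times> 'v) set" where
  "adj E \<equiv> {(x, y). {x, y} \<in> E}"

lemma reach_sym:
  assumes "(u, v) \<in> (adj E)\<^sup>*"
  shows "(v, u) \<in> (adj E)\<^sup>*"
proof -
  have "sym (adj E)" by (auto simp: sym_def insert_commute)
  then show ?thesis using assms by (metis sym_rtrancl symD)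
qed

lemma reach_mono:
  assumes "(u, v) \<in> (adj E)\<^sup>*" "E \<subseteq> F"
  shows "(u, v) \<in> (adj F)\<^sup>*"
proof -
  have "adj E \<subseteq> adj F" using assms(2) by auto
  then show ?thesis using assms(1) rtrancl_mono by blast
qed

lemma rtrancl_crossing:
  assumes "(u, v) \<in> r\<^sup>*" "P u" "\<not> P v"
  shows "\<exists>x y. (x, y) \<in> r \<and> P x \<and> \<not> P y"
  using assms by (induction rule: rtrancl_induct) blast+

text \<open>A walk using the new edge reaches one of its ends before the first use and leaves from
  one of its ends after the last. If these ends coincide, everything between can be cut out.\<close>

lemma reach_insert:
  assumes "(u, v) \<in> (adj (insert {x, y} F))\<^sup>*"
  shows "(u, v) \<in> (adj F)\<^sup>* \<or> (u, x) \<in> (adj F)\<^sup>* \<and> (y, v) \<in> (adj F)\<^sup>*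
    \<or> (u, y) \<in> (adj F)\<^sup>* \<and> (x, v) \<in> (adj F)\<^sup>*"
  using assms
proof (induction rule: rtrancl_induct)
  case base
  show ?case by simp
next
  case (step v w)
  show ?case
  proof (cases "{v, w} \<in> F")
    case True
    then have "(v, w) \<in> adj F" by simp
    then show ?thesis using step.IH by (meson rtrancl.rtrancl_into_rtrancl)
  next
    case False
    then have "v = x \<and> w = y \<or> v = y \<and> w = x"
      using step.hyps by (auto simp: doubleton_eq_iff)
    then show ?thesis using step.IH by blast
  qed
qed

text \<open>Every use of the edge can be rerouted inside \<open>G\<close>. All exchanges of tree
  edges below rest on this.\<close>

lemma reach_replace:
  assumes "(u, v) \<in> (adj (insert {x, y} F))\<^sup>*" "F \<subseteq> G" "(x, y) \<in> (adj G)\<^sup>*"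
  shows "(u, v) \<in> (adj G)\<^sup>*"
  using reach_insert[OF assms(1)] reach_mono[OF _ assms(2)] assms(3) reach_sym[OF assms(3)]
  by (meson rtrancl_trans)

lemma graph_connected_replace:
  assumes "graph_connected V (insert {x, y} F)" "F \<subseteq> G" "(x, y) \<in> (adj G)\<^sup>*"
  shows "graph_connected V G"
  using assms(1) reach_replace[OF _ assms(2,3)] unfolding graph_connected_def by blast

section \<open>Cycles and bridges\<close>

lemma reach_simple_path:
  assumes "(u, v) \<in> (adj F)\<^sup>*"
  shows "\<exists>xs. xs \<noteq> [] \<and> hd xs = u \<and> last xs = v \<and> distinct xs
    \<and> successively (\<lambda>x y. {x, y} \<in> F) xs"
  using assms
proof (induction rule: converse_rtrancl_induct)
  case base
  show ?case by (rule exI[of _ "[v]"]) simp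
next
  case (step u w)
  then obtain xs where xs: "xs \<noteq> []" "hd xs = w" "last xs = v" "distinct xs"
    "successively (\<lambda>x y. {x, y} \<in> F) xs" by blast
  show ?case
  proof (cases "u \<in> set xs")
    \<comment> \<open>The new vertex already lies on the path, so the suffix starting there is the
      required path.\<close>
    case True
    then obtain ys zs where "xs = ys @ u # zs" by (meson split_list)
    then show ?thesis
      using xs by (intro exI[of _ "u # zs"]) (auto simp: successively_append_iff)
  next
    case False
    then show ?thesis
      using xs step.hyps by (intro exI[of _ "u # xs"]) (auto simp: successively_Cons)
  qed
qed

text \<open>A simple path between the ends that avoids the edge is closed to a cycle by it.\<close>

lemma cycle_if_not_bridge:
  assumes "{u, v} \<in> T" "u \<noteq> v" "(u, v) \<in> (adj (T - {{u, v}}))\<^sup>*"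
  shows "\<exists>xs. is_cycle T xs"
proof -
  obtain xs where xs: "xs \<noteq> []" "hd xs = u" "last xs = v" "distinct xs"
    "successively (\<lambda>x y. {x, y} \<in> T - {{u, v}}) xs"
    using reach_simple_path[OF assms(3)] by blast
  have edge: "{xs ! i, xs ! Suc i} \<in> T - {{u, v}}" if "Suc i < length xs" for i
    using xs(5) that by (auto simp: successively_conv_nth)
  have u: "xs ! 0 = u" and v: "xs ! (length xs - 1) = v"
    using xs(1-3) by (simp_all add: hd_conv_nth last_conv_nth)
  \<comment> \<open>One vertex would force u = v, and two would make the path the removed edge
    itself.\<close>
  have "length xs \<noteq> 1" using u v assms(2) by auto
  moreover have "length xs \<noteq> 2" using edge[of 0] u v by auto
  ultimately have len: "3 \<le> length xs" using xs(1) by (cases "length xs") auto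
  have "{xs ! i, xs ! (Suc i mod length xs)} \<in> T" if "i < length xs" for i
  proof (cases "Suc i < length xs")
    case True
    then show ?thesis using edge by simp
  next
    case False
    then have "i = length xs - 1" "Suc i mod length xs = 0" using that by (auto simp: not_less le_Suc_eq)
    then show ?thesis using u v assms(1) by (simp add: insert_commute)
  qed
  then have "is_cycle T xs" using len xs(4) by (simp add: is_cycle_def)
  then show ?thesis ..
qed

text \<open>The witness is the closing edge between the last and the first vertex: the rest of the
  cycle joins its ends without it.\<close>

lemma cycle_edge_not_bridge:
  assumes "is_cycle T xs"
  shows "\<exists>u v. {u, v} \<in> T \<and> (u, v) \<in> (adj (T - {{u, v}}))\<^sup>*"
proof -
  let ?n = "length xs"
  let ?u = "xs ! 0" and ?v = "xs ! (?n - 1)"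
  have len: "3 \<le> ?n" and dist: "distinct xs"
    and edge: "\<And>i. i < ?n \<Longrightarrow> {xs ! i, xs ! (Suc i mod ?n)} \<in> T"
    using assms by (auto simp: is_cycle_def)
  have "Suc (?n - 1) = ?n" using len by simp
  then have uv: "{?u, ?v} \<in> T"
    using edge[of "?n - 1"] len by (simp add: insert_commute)
  have "(?u, xs ! i) \<in> (adj (T - {{?u, ?v}}))\<^sup>*" if "i < ?n" for i
    using that
  proof (induction i)
    case 0
    show ?case by simp
  next
    case (Suc i)
    have "{xs ! i, xs ! Suc i} \<in> T" using edge[of i] Suc.prems by simp
    \<comment> \<open>As the vertices are distinct, a step of the path could coincide with the
      closing edge only in a cycle of two vertices.\<close>
    moreover have "{xs ! i, xs ! Suc i} \<noteq> {?u, ?v}"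
    proof
      assume "{xs ! i, xs ! Suc i} = {?u, ?v}"
      then have "xs ! i = ?u \<and> xs ! Suc i = ?v \<or> xs ! i = ?v \<and> xs ! Suc i = ?u"
        by (simp add: doubleton_eq_iff)
      moreover have "0 < ?n" "?n - 1 < ?n" "i < ?n" using len Suc.prems by auto
      ultimately have "i = 0 \<and> Suc i = ?n - 1 \<or> i = ?n - 1 \<and> Suc i = 0"
        using dist Suc.prems by (metis nth_eq_iff_index_eq)
      then show False using len by auto
    qed
    ultimately have "(xs ! i, xs ! Suc i) \<in> adj (T - {{?u, ?v}})" by simp
    then show ?case using Suc by (meson Suc_lessD rtrancl.rtrancl_into_rtrancl)
  qed
  moreover have "?n - 1 < ?n" using len by simp
  ultimately show ?thesis using uv by blast
qed

text \<open>Acyclicity becomes a condition on reachability, the form used in exchange arguments. The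
  hypothesis on \<open>card\<close> rules out loops, whose ends are joined trivially although they
  give no cycle in the sense of \<open>is_cycle\<close>.\<close>

lemma spanning_tree_iff_bridges:
  assumes "\<forall>e\<in>E. card e = 2"
  shows "spanning_tree V E T \<longleftrightarrow> T \<subseteq> E \<and> graph_connected V T
    \<and> (\<forall>u v. {u, v} \<in> T \<longrightarrow> (u, v) \<notin> (adj (T - {{u, v}}))\<^sup>*)"
proof -
  have "u \<noteq> v" if "{u, v} \<in> T" "T \<subseteq> E" for u v
    using assms that by force
  then have "T \<subseteq> E \<Longrightarrow> (\<exists>xs. is_cycle T xs) \<longleftrightarrow>
      (\<exists>u v. {u, v} \<in> T \<and> (u, v) \<in> (adj (T - {{u, v}}))\<^sup>*)"
    using cycle_if_not_bridge cycle_edge_not_bridge by metis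
  then show ?thesis unfolding spanning_tree_def by blast
qed

section \<open>Existence of spanning trees and exchange of edges\<close>

lemma simple_graph_finite_edges:
  assumes "simple_graph V E"
  shows "finite E"
proof (rule finite_subset)
  show "E \<subseteq> Pow V" "finite (Pow V)" using assms by (auto simp: simple_graph_def)
qed

text \<open>A connected subset of \<open>F\<close> with the fewest edges works: an edge that is not
  a bridge could be deleted.\<close>

lemma connected_contains_spanning_tree:
  assumes "simple_graph V E" "F \<subseteq> E" "graph_connected V F"
  shows "\<exists>T\<subseteq>F. spanning_tree V E T"
proof -
  have card2: "\<forall>e\<in>E. card e = 2" using assms(1) by (simp add: simple_graph_def)
  have "finite F" using finite_subset[OF assms(2) simple_graph_finite_edges[OF assms(1)]] .
  define P where "P G \<longleftrightarrow> G \<subseteq> F \<and> graph_connected V G" for G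
  have "P F" using assms(3) by (simp add: P_def)
  then obtain T where "P T" and least: "\<And>G. P G \<Longrightarrow> card T \<le> card G"
    using ex_has_least_nat[of P F card] by blast
  then have T: "T \<subseteq> F" "graph_connected V T" by (simp_all add: P_def)
  have "(u, v) \<notin> (adj (T - {{u, v}}))\<^sup>*" if "{u, v} \<in> T" for u v
  proof
    assume "(u, v) \<in> (adj (T - {{u, v}}))\<^sup>*"
    moreover have "graph_connected V (insert {u, v} (T - {{u, v}}))"
      using T that by (simp add: insert_absorb)
    ultimately have "graph_connected V (T - {{u, v}})"
      by (rule graph_connected_replace[OF _ subset_refl, rotated])
    then have "P (T - {{u, v}})" using T by (auto simp: P_def)
    then have "card T \<le> card (T - {{u, v}})" by (rule least)
    moreover have "card (T - {{u, v}}) < card T"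
      using that T \<open>finite F\<close> by (meson card_Diff1_less finite_subset)
    ultimately show False by simp
  qed
  then have "spanning_tree V E T"
    using T assms(2) by (simp add: spanning_tree_iff_bridges[OF card2])
  then show ?thesis using T(1) by blast
qed

lemma ex_is_mst:
  assumes "simple_graph V E" "graph_connected V E"
  shows "\<exists>T. is_mst V E c T"
proof -
  have "finite E" using simple_graph_finite_edges[OF assms(1)] .
  then have "finite {T. spanning_tree V E T}"
    by (rule finite_subset[rotated, OF finite_Pow_iff[THEN iffD2]]) (auto simp: spanning_tree_def)
  moreover have "{T. spanning_tree V E T} \<noteq> {}"
    using connected_contains_spanning_tree[OF assms(1) subset_refl assms(2)] by auto
  ultimately obtain T where "T \<in> {T. spanning_tree V E T}"
      "\<And>S. S \<in> {T. spanning_tree V E T} \<Longrightarrow> sum c T \<le> sum c S"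
    using ex_min_if_finite[of "sum c ` {T. spanning_tree V E T}"] by (auto simp: not_less)
  then have "is_mst V E c T" by (simp add: is_mst_def)
  then show ?thesis ..
qed

text \<open>Passing from \<open>F\<close> to a spanning tree inside it only drops nonnegative
  weights. Exchange arguments therefore need connectedness of the new edge set, but no proof that it
  is acyclic.\<close>

lemma is_mst_le_connected:
  assumes "simple_graph V E" "\<forall>e\<in>E. 0 \<le> c e" "is_mst V E c T" "F \<subseteq> E" "graph_connected V F"
  shows "sum c T \<le> sum c F"
proof -
  obtain S where S: "S \<subseteq> F" "spanning_tree V E S"
    using connected_contains_spanning_tree[OF assms(1,4,5)] by blast
  have "finite F" using finite_subset[OF assms(4) simple_graph_finite_edges[OF assms(1)]] .
  then have "sum c S \<le> sum c F" using S(1) assms(2,4) by (intro sum_mono2) auto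
  moreover have "sum c T \<le> sum c S" using assms(3) S(2) by (simp add: is_mst_def)
  ultimately show ?thesis by simp
qed

lemma is_mst_exchange:
  assumes "simple_graph V E" "\<forall>e\<in>E. 0 \<le> c e" "is_mst V E c T" "e \<in> T" "f \<in> E" "f \<notin> T"
    and "graph_connected V (insert f (T - {e}))"
  shows "c e \<le> c f"
proof -
  have "T \<subseteq> E" using assms(3) by (simp add: is_mst_def spanning_tree_def)
  then have "finite T" using finite_subset simple_graph_finite_edges[OF assms(1)] by blast
  have "sum c T \<le> sum c (insert f (T - {e}))"
    using assms \<open>T \<subseteq> E\<close> by (intro is_mst_le_connected) auto
  also have "\<dots> = c f + (sum c T - c e)"
    using assms(4,6) \<open>finite T\<close> by (simp add: sum_diff1)
  finally show ?thesis by simp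
qed

text \<open>Both directions swap edges. If lighter edges bypass a tree edge, one of them crosses the
  cut left by deleting it and is a cheaper replacement. For an edge outside the tree, minimality
  makes every edge of the tree path between its ends at most as heavy, and injectivity makes it
  strictly lighter.\<close>

lemma mem_mst_iff_not_reach_lighter:
  assumes G: "simple_graph V E" and nonneg: "\<forall>e\<in>E. 0 \<le> c e" and inj: "inj_on c E"
    and mst: "is_mst V E c T" and uv: "{u, v} \<in> E"
  shows "{u, v} \<in> T \<longleftrightarrow> (u, v) \<notin> (adj {f\<in>E. c f < c {u, v}})\<^sup>*"
proof
  let ?e = "{u, v}"
  have card2: "\<forall>e\<in>E. card e = 2" and E_Pow: "E \<subseteq> Pow V"
    using G by (auto simp: simple_graph_def)
  have TE: "T \<subseteq> E" and conn: "graph_connected V T"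
    using mst by (auto simp: is_mst_def spanning_tree_def)
  have V: "u \<in> V" "v \<in> V" using uv E_Pow by auto
  {
    assume e: "?e \<in> T"
    let ?F = "T - {?e}"
    have T_eq: "insert ?e ?F = T" using e by auto
    have bridge: "(u, v) \<notin> (adj ?F)\<^sup>*"
      using mst e spanning_tree_iff_bridges[OF card2] by (auto simp: is_mst_def)
    show "(u, v) \<notin> (adj {f\<in>E. c f < c ?e})\<^sup>*"
    proof
      assume "(u, v) \<in> (adj {f\<in>E. c f < c ?e})\<^sup>*"
      \<comment> \<open>The predicate describes the component of u after deletion of the tree edge;
        the lighter walk has to leave it.\<close>
      from rtrancl_crossing[OF this, of "\<lambda>y. (u, y) \<in> (adj ?F)\<^sup>*"] bridge
      have "\<exists>x y. {x, y} \<in> E \<and> c {x, y} < c ?e \<and> (u, x) \<in> (adj ?F)\<^sup>* \<and> (u, y) \<notin> (adj ?F)\<^sup>*"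
        by simp
      then obtain x y where xy: "{x, y} \<in> E" "c {x, y} < c ?e"
        and x: "(u, x) \<in> (adj ?F)\<^sup>*" and y: "(u, y) \<notin> (adj ?F)\<^sup>*" by blast
      let ?G = "insert {x, y} ?F"
      have "y \<in> V" using xy(1) E_Pow by auto
      then have "(u, y) \<in> (adj (insert ?e ?F))\<^sup>*"
        using conn V T_eq by (simp add: graph_connected_def)
      \<comment> \<open>In the tree, y is reachable from u, but only through the deleted edge, so it
        lies on the side of v.\<close>
      from reach_insert[OF this] have vy: "(v, y) \<in> (adj ?F)\<^sup>*" using y bridge by blast
      have "(x, y) \<in> adj ?F" if "{x, y} \<in> T" using that xy(2) by auto
      then have "{x, y} \<notin> T" using x y by (meson rtrancl.rtrancl_into_rtrancl)
      have "(u, x) \<in> (adj ?G)\<^sup>*" "(y, v) \<in> (adj ?G)\<^sup>*"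
        by (rule reach_mono[OF x] reach_mono[OF reach_sym[OF vy]], blast)+
      moreover have "(x, y) \<in> adj ?G" by simp
      ultimately have "(u, v) \<in> (adj ?G)\<^sup>*" by (meson rtrancl.rtrancl_into_rtrancl rtrancl_trans)
      moreover have "graph_connected V (insert ?e ?F)" using conn T_eq by simp
      ultimately have "graph_connected V ?G"
        by (rule graph_connected_replace[OF _ subset_insertI, rotated])
      then have "c ?e \<le> c {x, y}"
        using is_mst_exchange[OF G nonneg mst e xy(1) \<open>{x, y} \<notin> T\<close>] by simp
      then show False using xy(2) by simp
    qed
  }
  {
    assume not_reach: "(u, v) \<notin> (adj {f\<in>E. c f < c ?e})\<^sup>*"
    show "?e \<in> T"
    proof (rule ccontr)
      assume e: "?e \<notin> T"
      have "(u, v) \<in> (adj T)\<^sup>*" using conn V by (simp add: graph_connected_def)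
      \<comment> \<open>A smallest subset of \<open>T\<close> joining u and v plays the role of the
        tree path: by minimality each of its edges separates u from v within it.\<close>
      define P where "P G \<longleftrightarrow> G \<subseteq> T \<and> (u, v) \<in> (adj G)\<^sup>*" for G
      have "P T" using \<open>(u, v) \<in> (adj T)\<^sup>*\<close> by (simp add: P_def)
      then obtain F where "P F" and least: "\<And>G. P G \<Longrightarrow> card F \<le> card G"
        using ex_has_least_nat[of P T card] by blast
      then have F: "F \<subseteq> T" "(u, v) \<in> (adj F)\<^sup>*" by (simp_all add: P_def)
      have "finite F"
        using finite_subset[OF subset_trans[OF F(1) TE] simple_graph_finite_edges[OF G]] .
      have "\<not> F \<subseteq> {f\<in>E. c f < c ?e}" using not_reach
        by (rule contrapos_nn) (rule reach_mono[OF F(2)])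
      then obtain f where f: "f \<in> F" "\<not> c f < c ?e" using F(1) TE by blast
      have f_in: "f \<in> T" "f \<in> E" using f(1) F TE by auto
      then have "card f = 2" using card2 by simp
      then obtain x y where xy: "f = {x, y}" by (meson card_2_iff)
      have "(u, v) \<notin> (adj (F - {f}))\<^sup>*"
      proof
        assume "(u, v) \<in> (adj (F - {f}))\<^sup>*"
        then have "P (F - {f})" using F by (auto simp: P_def)
        then have "card F \<le> card (F - {f})" by (rule least)
        then show False using card_Diff1_less[OF \<open>finite F\<close> f(1)] by simp
      qed
      moreover have "insert {x, y} (F - {f}) = F" using f(1) xy by auto
      ultimately have "(u, x) \<in> (adj (F - {f}))\<^sup>* \<and> (y, v) \<in> (adj (F - {f}))\<^sup>*
          \<or> (u, y) \<in> (adj (F - {f}))\<^sup>* \<and> (x, v) \<in> (adj (F - {f}))\<^sup>*"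
        using reach_insert[of u v x y "F - {f}"] F by auto
      \<comment> \<open>Without \<open>f\<close> the tree path falls into two pieces that lead from
        u and v to the ends of \<open>f\<close>. Together with the edge uv they join these ends
        inside \<open>?G\<close>.\<close>
      moreover let ?G = "insert ?e (T - {f})"
      have "F - {f} \<subseteq> ?G" using F by auto
      then have "adj (F - {f}) \<subseteq> adj ?G" by auto
      then have "(adj (F - {f}))\<^sup>* \<subseteq> (adj ?G)\<^sup>*" by (rule rtrancl_mono)
      moreover have "(u, v) \<in> (adj ?G)\<^sup>*" by auto
      ultimately have "(x, y) \<in> (adj ?G)\<^sup>*"
      proof (elim disjE conjE)
        assume *: "(adj (F - {f}))\<^sup>* \<subseteq> (adj ?G)\<^sup>*" "(u, v) \<in> (adj ?G)\<^sup>*"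
          "(u, x) \<in> (adj (F - {f}))\<^sup>*" "(y, v) \<in> (adj (F - {f}))\<^sup>*"
        show ?thesis
          using reach_sym[OF subsetD[OF *(1,3)]] *(2) reach_sym[OF subsetD[OF *(1,4)]]
          by (rule rtrancl_trans[OF rtrancl_trans])
      next
        assume *: "(adj (F - {f}))\<^sup>* \<subseteq> (adj ?G)\<^sup>*" "(u, v) \<in> (adj ?G)\<^sup>*"
          "(u, y) \<in> (adj (F - {f}))\<^sup>*" "(x, v) \<in> (adj (F - {f}))\<^sup>*"
        show ?thesis
          using subsetD[OF *(1,4)] reach_sym[OF *(2)] subsetD[OF *(1,3)]
          by (rule rtrancl_trans[OF rtrancl_trans])
      qed
      moreover have "graph_connected V (insert {x, y} (T - {f}))"
        using conn xy f_in by (simp add: insert_absorb)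
      ultimately have "graph_connected V ?G"
        by (rule graph_connected_replace[OF _ subset_insertI, rotated])
      then have "c f \<le> c ?e"
        using is_mst_exchange[OF G nonneg mst f_in(1) uv e] by simp
      then have "c f = c ?e" using f(2) by simp
      then have "f = ?e" using inj f_in(2) uv by (meson inj_onD)
      then show False using e f_in(1) by simp
    qed
  }
qed

text \<open>Uniqueness follows from the criterion for membership, whose right-hand side does not
  mention the tree.\<close>

lemma ex1_is_mst:
  assumes "simple_graph V E" "graph_connected V E" "\<forall>e\<in>E. 0 \<le> c e" "inj_on c E"
  shows "\<exists>!T. is_mst V E c T"
proof -
  obtain T where T: "is_mst V E c T" using ex_is_mst[OF assms(1,2)] by blast
  moreover have "S = T" if S: "is_mst V E c S" for S
  proof -
    have "S \<subseteq> E" "T \<subseteq> E" using S T by (auto simp: is_mst_def spanning_tree_def)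
    moreover have "e \<in> S \<longleftrightarrow> e \<in> T" if e: "e \<in> E" for e
    proof -
      have "card e = 2" using e assms(1) by (simp add: simple_graph_def)
      then obtain u v where "e = {u, v}" by (meson card_2_iff)
      then show ?thesis
        using mem_mst_iff_not_reach_lighter[OF assms(1,3,4) S] e
          mem_mst_iff_not_reach_lighter[OF assms(1,3,4) T] by simp
    qed
    ultimately show ?thesis by blast
  qed
  ultimately show ?thesis by blast
qed

lemma mem_mst_iff:
  assumes "simple_graph V E" "graph_connected V E" "\<forall>e\<in>E. 0 \<le> c e" "inj_on c E" "{u, v} \<in> E"
  shows "{u, v} \<in> mst V E c \<longleftrightarrow> (u, v) \<notin> (adj {f\<in>E. c f < c {u, v}})\<^sup>*"
  unfolding mst_def
  using mem_mst_iff_not_reach_lighter[OF assms(1,3,4) theI'[OF ex1_is_mst[OF assms(1-4)]] assms(5)] .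

subsection \<open>The complete graph on four vertices\<close>

text \<open>
  With edges between four vertices \<open>a\<close>, \<open>b\<close>, \<open>c\<close>, \<open>d\<close> given by the Boolean arguments, and no edge
  \<open>ab\<close>, this says that \<open>a\<close> and \<open>b\<close> lie in different components. The fifth argument is the edge \<open>cd\<close>
  (primed because \<open>cd\<close> is a constant).
\<close>

definition separated4 :: "bool \<Rightarrow> bool \<Rightarrow> bool \<Rightarrow> bool \<Rightarrow> bool \<Rightarrow> bool" where
  "separated4 ac bc ad bd cd' \<longleftrightarrow> \<not> (ac \<and> bc) \<and> \<not> (ad \<and> bd) \<and>
     (cd' \<longrightarrow> \<not> ac \<and> \<not> ad \<or> \<not> bc \<and> \<not> bd)"

text \<open>Apart from the edge ab itself, a simple path from a to b passes through c, d or both;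
  \<open>separated4\<close> excludes exactly these four paths.\<close>

lemma not_reach_four_vertices_iff:
  assumes dist: "distinct [a, b, c, d]" and L: "\<And>e. e \<in> L \<Longrightarrow> e \<subseteq> {a, b, c, d}"
    and ab: "{a, b} \<notin> L"
  shows "(a, b) \<notin> (adj L)\<^sup>* \<longleftrightarrow>
    separated4 ({a, c} \<in> L) ({b, c} \<in> L) ({a, d} \<in> L) ({b, d} \<in> L) ({c, d} \<in> L)"
proof
  assume nr: "(a, b) \<notin> (adj L)\<^sup>*"
  have *: "\<not> ({a, x} \<in> L \<and> {b, x} \<in> L)" for x
  proof
    assume "{a, x} \<in> L \<and> {b, x} \<in> L"
    then have "(a, x) \<in> adj L" "(x, b) \<in> adj L" by (simp_all add: insert_commute)
    then show False using nr by (meson converse_rtrancl_into_rtrancl r_into_rtrancl)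
  qed
  have **: "\<not> ({a, x} \<in> L \<and> {x, y} \<in> L \<and> {b, y} \<in> L)" for x y
  proof
    assume "{a, x} \<in> L \<and> {x, y} \<in> L \<and> {b, y} \<in> L"
    then have "(a, x) \<in> adj L" "(x, y) \<in> adj L" "(y, b) \<in> adj L" by (simp_all add: insert_commute)
    then show False using nr by (meson converse_rtrancl_into_rtrancl r_into_rtrancl)
  qed
  show "separated4 ({a, c} \<in> L) ({b, c} \<in> L) ({a, d} \<in> L) ({b, d} \<in> L) ({c, d} \<in> L)"
    unfolding separated4_def
    using *[of c] *[of d] **[of c d] **[of d c] by (simp only: insert_commute[of d c]) blast
next
  assume sep: "separated4 ({a, c} \<in> L) ({b, c} \<in> L) ({a, d} \<in> L) ({b, d} \<in> L) ({c, d} \<in> L)"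
  \<comment> \<open>\<open>P\<close> is the set of vertices reachable from a without passing through
    b; under \<open>separated4\<close> no edge of \<open>L\<close> leaves it.\<close>
  define P where "P x \<longleftrightarrow> x = a \<or> x = c \<and> ({a, c} \<in> L \<or> {a, d} \<in> L \<and> {c, d} \<in> L)
    \<or> x = d \<and> ({a, d} \<in> L \<or> {a, c} \<in> L \<and> {c, d} \<in> L)" for x
  show "(a, b) \<notin> (adj L)\<^sup>*"
  proof
    assume "(a, b) \<in> (adj L)\<^sup>*"
    moreover have "P a" "\<not> P b" using dist by (auto simp: P_def)
    ultimately obtain x y where xy: "{x, y} \<in> L" "P x" "\<not> P y"
      using rtrancl_crossing[of a b "adj L" P] by blast
    have "y \<in> {a, b, c, d}" using L[OF xy(1)] by simp
    then have y: "y = b \<or> y = c \<or> y = d" using xy(3) by (auto simp: P_def)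
    have x: "x = a \<or> x = c \<or> x = d" using xy(2) by (auto simp: P_def)
    have comm: "{c, b} = {b, c}" "{d, b} = {b, d}" "{d, c} = {c, d}" by auto
    from x y show False
      using xy sep dist ab unfolding P_def separated4_def
      by (elim disjE) (simp_all only: comm, simp_all)
  qed
qed

section \<open>The edges of the complete graph and membership in its minimum spanning tree\<close>

lemma K4_E_eq: "K4_E = {{0, 1}, {2, 3}, {0, 2}, {0, 3}, {1, 2}, {1, 3}}"
proof -
  have A: "e \<in> {{0, 1}, {2, 3}, {0, 2}, {0, 3}, {1, 2}, {1, 3}}"
    if e: "e \<subseteq> {0, 1, 2, 3}" "card e = 2" for e :: "nat set"
  proof -
    obtain x y where xy: "e = {x, y}" "x \<noteq> y" using e(2) by (meson card_2_iff)
    then have "x \<in> {0, 1, 2, 3}" "y \<in> {0, 1, 2, 3}" using e(1) by auto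
    then show ?thesis using xy by (elim insertE emptyE) (simp_all add: insert_commute)
  qed
  have B: "e \<subseteq> {0, 1, 2, 3} \<and> card e = 2"
    if "e \<in> {{0, 1}, {2, 3}, {0, 2}, {0, 3}, {1, 2}, {1, 3}}" for e :: "nat set"
    using that by (elim insertE emptyE) simp_all
  show ?thesis
    unfolding K4_E_def K4_V_def
    by (rule set_eqI, unfold mem_Collect_eq, rule iffI, elim conjE, rule A, assumption+, rule B)
qed

lemma finite_K4_E [simp]: "finite K4_E"
  by (simp add: K4_E_eq)

lemma simple_graph_K4: "simple_graph K4_V K4_E"
  by (simp add: simple_graph_def K4_E_def K4_V_def)

lemma graph_connected_K4: "graph_connected K4_V K4_E"
proof -
  have "(u, v) \<in> (adj K4_E)\<^sup>*" if "u \<in> K4_V" "v \<in> K4_V" for u v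
  proof (cases "u = v")
    case False
    then have "{u, v} \<in> K4_E" using that by (simp add: K4_E_def)
    then show ?thesis by (intro r_into_rtrancl) simp
  qed simp
  then show ?thesis by (auto simp: graph_connected_def K4_V_def)
qed

context
  fixes c :: "nat set \<Rightarrow> real"
  assumes nonneg: "\<forall>e\<in>K4_E. 0 \<le> c e" and inj: "inj_on c K4_E"
begin

lemma ab_mem_mst_K4_iff:
  "ab \<in> mst K4_V K4_E c \<longleftrightarrow> separated4 (c {0, 2} < c ab) (c {1, 2} < c ab)
     (c {0, 3} < c ab) (c {1, 3} < c ab) (c cd < c ab)"
proof -
  let ?L = "{f \<in> K4_E. c f < c {0, 1}}"
  have "e \<subseteq> {0, 1, 2, 3}" if "e \<in> ?L" for e
    using that by (auto simp: K4_E_def K4_V_def)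
  then have "(0, 1) \<notin> (adj ?L)\<^sup>* \<longleftrightarrow>
      separated4 ({0, 2} \<in> ?L) ({1, 2} \<in> ?L) ({0, 3} \<in> ?L) ({1, 3} \<in> ?L) ({2, 3} \<in> ?L)"
    by (intro not_reach_four_vertices_iff) simp_all
  moreover have "{0, 1} \<in> K4_E" by (simp add: K4_E_eq)
  ultimately show ?thesis
    using mem_mst_iff[OF simple_graph_K4 graph_connected_K4 nonneg inj, of 0 1]
    by (simp add: ab_def cd_def K4_E_eq)
qed

text \<open>The separation criterion with the vertices in the order 2, 3, 0, 1. This makes
  \<open>{0, 3}\<close> and \<open>{1, 2}\<close> trade places compared with the criterion for
  \<open>ab\<close>.\<close>

lemma cd_mem_mst_K4_iff:
  "cd \<in> mst K4_V K4_E c \<longleftrightarrow> separated4 (c {0, 2} < c cd) (c {0, 3} < c cd)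
     (c {1, 2} < c cd) (c {1, 3} < c cd) (c ab < c cd)"
proof -
  let ?L = "{f \<in> K4_E. c f < c {2, 3}}"
  have "e \<subseteq> {2, 3, 0, 1}" if "e \<in> ?L" for e
    using that by (auto simp: K4_E_def K4_V_def)
  then have "(2, 3) \<notin> (adj ?L)\<^sup>* \<longleftrightarrow>
      separated4 ({2, 0} \<in> ?L) ({3, 0} \<in> ?L) ({2, 1} \<in> ?L) ({3, 1} \<in> ?L) ({0, 1} \<in> ?L)"
    by (intro not_reach_four_vertices_iff) simp_all
  moreover have "{2, 3} \<in> K4_E" by (simp add: K4_E_eq)
  moreover have "{2, 0} = {0, 2::nat}" "{3, 0} = {0, 3::nat}" "{2, 1} = {1, 2::nat}"
    "{3, 1} = {1, 3::nat}" by auto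
  ultimately show ?thesis
    using mem_mst_iff[OF simple_graph_K4 graph_connected_K4 nonneg inj, of 2 3]
    by (simp add: ab_def cd_def K4_E_eq)
qed

end

subsection \<open>The laws of the edge weights\<close>

lemma
  assumes t: "t \<ge> 1"
  shows real_distribution_power_law: "real_distribution (power_law t)"
    and cdf_power_law: "cdf (power_law t) = (\<lambda>x. (max 0 (min 1 x)) ^ t)"
proof -
  let ?F = "\<lambda>x :: real. (max 0 (min 1 x)) ^ t"
  have mono: "?F x \<le> ?F y" if "x \<le> y" for x y
    using that by (intro power_mono) auto
  have "isCont ?F x" for x by (intro continuous_intros)
  then have cont: "continuous (at_right x) ?F" for x
    by (rule continuous_within_subset) simp
  have bot: "(?F \<longlongrightarrow> 0) at_bot"
    using t by (intro tendsto_eventually eventually_mono[OF eventually_le_at_bot[of 0]]) auto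
  have top: "(?F \<longlongrightarrow> 1) at_top"
    by (intro tendsto_eventually eventually_mono[OF eventually_ge_at_top[of 1]]) auto
  show "real_distribution (power_law t)"
    unfolding power_law_def by (intro real_distribution_interval_measure mono cont bot top)
  show "cdf (power_law t) = ?F"
    unfolding power_law_def by (intro cdf_interval_measure mono cont bot)
qed

lemma prob_space_power_law: "t \<ge> 1 \<Longrightarrow> prob_space (power_law t)"
  using real_distribution_power_law real_distribution.axioms(1) by blast

lemma sets_power_law [simp, measurable_cong]: "sets (power_law t) = sets borel"
  by (simp add: power_law_def)

lemma space_power_law [simp]: "space (power_law t) = UNIV"
  by (simp add: power_law_def)

text \<open>Both sides are finite measures with the same distribution function; that of the density
  comes from the antiderivative \<open>y ^ t\<close>.\<close>

lemma power_law_eq_density: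
  assumes t: "t \<ge> 1"
  shows "power_law t = density lborel (\<lambda>x. ennreal (real t * x ^ (t - 1) * indicator {0..1} x))"
    (is "_ = ?D")
proof (rule cdf_unique')
  let ?f = "\<lambda>x :: real. real t * x ^ (t - 1)"
  have Iic: "emeasure ?D {..x} = ennreal ((max 0 (min 1 x)) ^ t)" for x
  proof -
    have "emeasure ?D {..x}
      = (\<integral>\<^sup>+y. ennreal (?f y * indicator {0..1} y) * indicator {..x} y \<partial>lborel)"
      by (simp add: emeasure_density)
    also have "\<dots> = (\<integral>\<^sup>+y. ennreal (?f y) * indicator {0..max 0 (min 1 x)} y \<partial>lborel)"
    \<comment> \<open>For negative x the interval on the right degenerates to the point 0 while the
      left one is empty, so equality is claimed only off 0.\<close>
    proof (rule nn_integral_cong_AE)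
      show "AE y in lborel. ennreal (?f y * indicator {0..1} y) * indicator {..x} y
          = ennreal (?f y) * indicator {0..max 0 (min 1 x)} y"
        using AE_lborel_singleton[of 0]
        by (rule AE_mp) (auto simp: indicator_def max_def min_def)
    qed
    also have "\<dots> = ennreal ((max 0 (min 1 x)) ^ t - 0 ^ t)"
    proof (rule nn_integral_FTC_Icc)
      fix y :: real
      assume "y \<in> {0..max 0 (min 1 x)}"
      then show "0 \<le> ?f y" by simp
      show "((\<lambda>y. y ^ t) has_real_derivative ?f y) (at y)"
        by (auto intro!: derivative_eq_intros)
    qed auto
    finally show ?thesis using t by (simp add: power_0_left)
  qed
  show "finite_borel_measure (power_law t)"
    using real_distribution_power_law[OF t] by (rule real_distribution.finite_borel_measure_M)
  have "emeasure ?D UNIV = (\<integral>\<^sup>+y. ennreal (?f y) * indicator {0..1} y \<partial>lborel)"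
    by (auto simp: emeasure_density intro!: nn_integral_cong split: split_indicator)
  also have "\<dots> = ennreal (1 ^ t - 0 ^ t)"
  proof (rule nn_integral_FTC_Icc)
    fix y :: real
    assume "y \<in> {0..1}"
    then show "0 \<le> ?f y" by simp
    show "((\<lambda>y. y ^ t) has_real_derivative ?f y) (at y)"
      by (auto intro!: derivative_eq_intros)
  qed auto
  finally have "emeasure ?D (space ?D) < \<infinity>" by simp
  then show "finite_borel_measure ?D"
    by (auto simp: finite_borel_measure_def finite_borel_measure_axioms_def intro!: finite_measureI)
  show "cdf (power_law t) = cdf ?D"
    unfolding cdf_power_law[OF t] by (rule ext) (simp only: cdf_def measure_def Iic, simp)
qed

text \<open>Places the uniform law in the same family as the other one, so that all six weights can
  be treated together.\<close>

lemma unif01_eq_power_law: "unif01 = power_law 1"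
proof -
  have "unif01 = density lborel (\<lambda>x. indicator {0..1} x / emeasure lborel {0..1::real})"
    by (simp add: unif01_def uniform_measure_def)
  also have "\<dots> = power_law 1"
    unfolding power_law_eq_density[OF order_refl]
    by (intro density_cong) (auto split: split_indicator simp: ennreal_1[symmetric] simp del: ennreal_1)
  finally show ?thesis .
qed

text \<open>The open truncation matches the strict comparisons between weights. The fundamental
  theorem of calculus gives the integral over \<open>{0..x}\<close>, and the endpoint x is
  null.\<close>

lemma power_law_truncated_moment:
  assumes t: "t \<ge> 1" and x: "0 \<le> x" "x \<le> 1"
  shows "has_bochner_integral (power_law t) (\<lambda>z. z ^ k * indicator {..<x} z)
    (real t / real (t + k) * x ^ (t + k))"
proof -
  let ?f = "\<lambda>z. real t * z ^ (t + k - 1)"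
  have deriv: "DERIV (\<lambda>z. real t / real (t + k) * z ^ (t + k)) z :> ?f z" for z
    using t by (rule_tac derivative_eq_intros refl)+ simp
  have "has_bochner_integral lborel (\<lambda>z. ?f z * indicator {0..x} z)
      (real t / real (t + k) * x ^ (t + k) - real t / real (t + k) * 0 ^ (t + k))"
    by (intro has_bochner_integral_FTC_Icc_real deriv x continuous_intros)
  then have "has_bochner_integral lborel (\<lambda>z. ?f z * indicator {0..x} z)
      (real t / real (t + k) * x ^ (t + k))" using t by (simp add: power_0_left)
  moreover have "AE z in lborel. (real t * z ^ (t - 1) * indicator {0..1} z)
      *\<^sub>R (z ^ k * indicator {..<x} z) = ?f z * indicator {0..x} z"
  proof -
    have "t + k - 1 = (t - 1) + k" using t by simp
    then show ?thesis
      using AE_lborel_singleton[of x] x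
      by (auto elim!: eventually_mono simp: power_add indicator_def)
  qed
  ultimately have "has_bochner_integral lborel
      (\<lambda>z. (real t * z ^ (t - 1) * indicator {0..1} z) *\<^sub>R (z ^ k * indicator {..<x} z))
      (real t / real (t + k) * x ^ (t + k))"
    by (subst has_bochner_integral_cong_AE) auto
  then show ?thesis
    unfolding power_law_eq_density[OF t]
    by (intro has_bochner_integral_density) (auto split: split_indicator)
qed

lemma AE_power_law_Icc:
  assumes t: "t \<ge> 1"
  shows "AE x in power_law t. x \<in> {0..1}"
  unfolding power_law_eq_density[OF t] by (subst AE_density) (auto split: split_indicator)

lemma AE_power_law_neq:
  assumes t: "t \<ge> 1"
  shows "AE x in power_law t. x \<noteq> a"
  unfolding power_law_eq_density[OF t]
  using AE_lborel_singleton[of a] by (subst AE_density) (auto elim: eventually_mono)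

text \<open>The maximum is at most a exactly when all coordinates are, so its distribution function
  is a t-th power.\<close>

lemma distr_Max_unif01:
  assumes t: "t \<ge> 1"
  shows "distr (PiM {..<t} (\<lambda>_. unif01)) borel (\<lambda>x. Max (x ` {..<t})) = power_law t"
proof (rule cdf_unique)
  interpret unif: prob_space "power_law 1" by (rule prob_space_power_law) simp
  let ?P = "PiM {..<t} (\<lambda>_. power_law 1)"
  interpret P: prob_space ?P by (intro prob_space_PiM unif.prob_space_axioms)
  interpret product_sigma_finite "\<lambda>_. power_law 1" ..
  have "(\<lambda>x. x i) \<in> borel_measurable ?P" if "i \<in> {..<t}" for i
    using measurable_component_singleton[OF that, of "\<lambda>_. power_law 1"]
    by (simp cong: measurable_cong_sets)
  then have meas [measurable]: "(\<lambda>x. Max (x ` {..<t})) \<in> borel_measurable ?P"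
    by (intro borel_measurable_Max) auto
  show "real_distribution (distr (PiM {..<t} (\<lambda>_. unif01)) borel (\<lambda>x. Max (x ` {..<t})))"
    unfolding unif01_eq_power_law by (rule P.real_distribution_distr) (rule meas)
  show "real_distribution (power_law t)" using t by (rule real_distribution_power_law)
  have "cdf (distr ?P borel (\<lambda>x. Max (x ` {..<t}))) a = (max 0 (min 1 a)) ^ t" for a
  proof -
    have Max_le: "Max (x ` {..<t}) \<le> a \<longleftrightarrow> (\<forall>i\<in>{..<t}. x i \<le> a)" for x :: "nat \<Rightarrow> real"
      using t by (subst Max_le_iff) (simp_all add: lessThan_empty_iff)
    have "(\<lambda>x. Max (x ` {..<t})) -` {..a} \<inter> space ?P = PiE {..<t} (\<lambda>_. {..a})"
      by (rule set_eqI) (simp add: space_PiM PiE_iff Max_le conj_commute)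
    then have "emeasure (distr ?P borel (\<lambda>x. Max (x ` {..<t}))) {..a}
        = emeasure ?P (PiE {..<t} (\<lambda>_. {..a}))"
      by (simp add: emeasure_distr)
    also have "\<dots> = ennreal (measure (power_law 1) {..a}) ^ t"
      by (subst emeasure_PiM) (simp_all add: unif.emeasure_eq_measure del: One_nat_def)
    also have "measure (power_law 1) {..a} = max 0 (min 1 a)"
      using fun_cong[OF cdf_power_law[OF order_refl], of a] by (simp add: cdf_def)
    finally have "emeasure (distr ?P borel (\<lambda>x. Max (x ` {..<t}))) {..a}
        = ennreal ((max 0 (min 1 a)) ^ t)" by (simp only: ennreal_power max.cobounded1)
    then show ?thesis unfolding cdf_def measure_def by simp
  qed
  then show "cdf (distr (PiM {..<t} (\<lambda>_. unif01)) borel (\<lambda>x. Max (x ` {..<t}))) = cdf (power_law t)"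
    unfolding unif01_eq_power_law cdf_power_law[OF t] by (rule ext)
qed

subsection \<open>Measurability and transfer to the canonical space\<close>

text \<open>Points of a product space are extensional on the index set, while families of random
  variables need not be. Spanning trees only see weights on \<open>E\<close>, so either form may be
  used.\<close>

lemma is_mst_restrict: "is_mst V E (restrict c E) T \<longleftrightarrow> is_mst V E c T"
proof -
  have "sum (restrict c E) T = sum c T" if "spanning_tree V E T" for T
    using that by (intro sum.cong) (auto simp: spanning_tree_def)
  then show ?thesis unfolding is_mst_def by auto
qed

lemma mst_restrict: "mst V E (restrict c E) = mst V E c"
  unfolding mst_def is_mst_restrict ..

text \<open>The value of \<open>mst\<close> depends only on the set of minimizers, and there are
  finitely many candidates for this set. The event is a finite union over them, which also covers
  weights where the minimizer is not unique.\<close>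

lemma measurable_pred_mst:
  assumes "simple_graph V E"
  shows "Measurable.pred (PiM E (\<lambda>_. borel)) (\<lambda>c. Q (mst V E c))"
proof -
  have fin: "finite (Pow E)" "finite (Pow (Pow E))"
    using simple_graph_finite_edges[OF assms] by simp_all
  define S where "S c = {T \<in> Pow E. is_mst V E c T}" for c
  have is_mst_iff: "is_mst V E c T \<longleftrightarrow> spanning_tree V E T \<and>
      (\<forall>T'\<in>Pow E. spanning_tree V E T' \<longrightarrow> (\<Sum>e\<in>T. c e) \<le> (\<Sum>e\<in>T'. c e))" for c T
    by (auto simp: is_mst_def spanning_tree_def)
  have sum_meas: "(\<lambda>c. \<Sum>e\<in>T. c e :: real) \<in> borel_measurable (PiM E (\<lambda>_. borel))" if "T \<in> Pow E" for T
    using that by (intro borel_measurable_sum measurable_component_singleton) auto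
  have [measurable]: "Measurable.pred (PiM E (\<lambda>_. borel)) (\<lambda>c. is_mst V E c T)" if "T \<in> Pow E" for T
    unfolding is_mst_iff using that
    by (intro pred_intros_logic pred_intros_finite fin)
      (simp, simp, unfold pred_def, intro borel_measurable_le sum_meas)
  have mst_eq: "mst V E c = (THE T. T \<in> S c)" for c
    unfolding mst_def S_def
    by (rule arg_cong[where f = The], rule ext) (auto simp: is_mst_def spanning_tree_def)
  have "Q (mst V E c) \<longleftrightarrow> (\<exists>A\<in>Pow (Pow E). Q (THE T. T \<in> A) \<and> S c = A)" for c
    unfolding mst_eq by (auto simp: S_def)
  also have "\<dots> c \<longleftrightarrow> (\<exists>A\<in>Pow (Pow E). Q (THE T. T \<in> A) \<and> (\<forall>T\<in>Pow E. is_mst V E c T \<longleftrightarrow> T \<in> A))" for c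
    by (intro bex_cong refl conj_cong) (auto simp: S_def)
  finally have iff: "Q (mst V E c) \<longleftrightarrow>
      (\<exists>A\<in>Pow (Pow E). Q (THE T. T \<in> A) \<and> (\<forall>T\<in>Pow E. is_mst V E c T \<longleftrightarrow> T \<in> A))" for c .
  show ?thesis unfolding iff
    by (intro pred_intros_logic pred_intros_finite fin) measurable
qed

section \<open>Products of power laws\<close>

lemma product_sigma_finite_power_law:
  assumes "\<And>i. k i \<ge> 1"
  shows "product_sigma_finite (\<lambda>i. power_law (k i))"
  unfolding product_sigma_finite_def
  using prob_space_power_law[OF assms] prob_space_imp_sigma_finite by blast

lemma prob_space_PiM_power_law:
  assumes "\<And>i. k i \<ge> 1"
  shows "prob_space (PiM J (\<lambda>i. power_law (k i)))"
  by (intro prob_space_PiM prob_space_power_law assms)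

context
  fixes I :: "'i set" and k :: "'i \<Rightarrow> nat"
  assumes fin: "finite I" and k: "\<And>i. k i \<ge> 1"
begin

lemma AE_PiM_power_law_Icc: "AE \<omega> in PiM I (\<lambda>i. power_law (k i)). \<forall>i\<in>I. \<omega> i \<in> {0..1}"
  using fin by (intro AE_finite_allI AE_PiM_component prob_space_power_law AE_power_law_Icc k)

text \<open>Coordinate i is integrated first: with the others fixed, a tie means hitting the single
  value of coordinate j, which is a null event.\<close>

lemma AE_PiM_power_law_neq:
  assumes "i \<in> I" "j \<in> I" "i \<noteq> j"
  shows "AE \<omega> in PiM I (\<lambda>i. power_law (k i)). \<omega> i \<noteq> \<omega> j"
proof -
  let ?M = "\<lambda>i. power_law (k i)"
  interpret product_sigma_finite ?M by (rule product_sigma_finite_power_law) (rule k)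
  define J where "J = I - {i}"
  have I: "I = insert i J" and J: "finite J" "i \<notin> J" "j \<in> J" using assms fin by (auto simp: J_def)
  let ?N = "{\<omega> \<in> space (PiM I ?M). \<omega> i = \<omega> j}"
  have N: "?N \<in> sets (PiM I ?M)" using assms by measurable
  have "emeasure (PiM I ?M) ?N = (\<integral>\<^sup>+\<omega>. indicator ?N \<omega> \<partial>PiM (insert i J) ?M)"
    using N by (simp add: I)
  also have "\<dots> = (\<integral>\<^sup>+x. (\<integral>\<^sup>+y. indicator ?N (x(i := y)) \<partial>?M i) \<partial>PiM J ?M)"
    using J N by (intro product_nn_integral_insert) (auto simp: I)
  also have "\<dots> = (\<integral>\<^sup>+x. 0 \<partial>PiM J ?M)"
  proof (rule nn_integral_cong)
    fix x
    assume "x \<in> space (PiM J ?M)"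
    have "(\<integral>\<^sup>+y. indicator ?N (x(i := y)) \<partial>?M i) = (\<integral>\<^sup>+y. 0 \<partial>?M i)"
      using AE_power_law_neq[OF k, of "x j" i] assms(3)
      by (intro nn_integral_cong_AE) (auto elim!: eventually_mono simp: indicator_def)
    then show "(\<integral>\<^sup>+y. indicator ?N (x(i := y)) \<partial>?M i) = 0" by simp
  qed
  finally have "?N \<in> null_sets (PiM I ?M)" using N by (simp add: null_sets_def)
  then show ?thesis by (rule AE_I') auto
qed

lemma AE_PiM_power_law_inj_on: "AE \<omega> in PiM I (\<lambda>i. power_law (k i)). inj_on \<omega> I"
proof -
  have "AE \<omega> in PiM I (\<lambda>i. power_law (k i)). \<forall>i\<in>I. \<forall>j\<in>I. i \<noteq> j \<longrightarrow> \<omega> i \<noteq> \<omega> j"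
    using fin AE_PiM_power_law_neq by (intro AE_finite_allI) auto
  then show ?thesis by (rule eventually_mono) (auto simp: inj_on_def)
qed

end

text \<open>Exponent 1 is the uniform law, which turns \<open>K4_space\<close> into a product of
  power laws.\<close>

definition K4_exponent :: "nat \<Rightarrow> nat set \<Rightarrow> nat" where
  "K4_exponent t e = (if e \<in> {ab, cd} then t else 1)"

lemma K4_exponent_ge_1: "t \<ge> 1 \<Longrightarrow> K4_exponent t e \<ge> 1"
  by (simp add: K4_exponent_def)

lemma K4_space_eq: "K4_space t = PiM K4_E (\<lambda>e. power_law (K4_exponent t e))"
  unfolding K4_space_def K4_exponent_def unif01_eq_power_law by (intro PiM_cong) auto

lemma prob_space_K4_space: "t \<ge> 1 \<Longrightarrow> prob_space (K4_space t)"
  unfolding K4_space_eq by (intro prob_space_PiM prob_space_power_law K4_exponent_ge_1)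

lemma sets_K4_space: "sets (K4_space t) = sets (PiM K4_E (\<lambda>_. borel))"
  unfolding K4_space_eq by (intro sets_PiM_cong) auto

lemma AE_K4_space:
  assumes "t \<ge> 1"
  shows "AE \<omega> in K4_space t. (\<forall>e\<in>K4_E. \<omega> e \<in> {0..1}) \<and> inj_on \<omega> K4_E"
  unfolding K4_space_eq
  using AE_PiM_power_law_Icc[of K4_E, OF finite_K4_E K4_exponent_ge_1[OF assms]]
    AE_PiM_power_law_inj_on[of K4_E, OF finite_K4_E K4_exponent_ge_1[OF assms]]
  by eventually_elim simp

lemma AE_K4_space_ex1_mst:
  assumes "t \<ge> 1"
  shows "AE \<omega> in K4_space t. \<exists>!T. is_mst K4_V K4_E \<omega> T"
  using AE_K4_space[OF assms]
  by (rule eventually_mono) (intro ex1_is_mst simple_graph_K4 graph_connected_K4, auto)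

text \<open>Independence makes the joint law the product of its marginals, and the hypotheses
  determine each marginal. Every realization thus has the canonical joint law.\<close>

lemma
  assumes t: "t \<ge> 1" and w: "K4_weights t M w"
  shows K4_weights_measurable: "(\<lambda>\<omega>. \<lambda>e\<in>K4_E. w e \<omega>) \<in> measurable M (PiM K4_E (\<lambda>_. borel))"
    and K4_weights_distr: "distr M (PiM K4_E (\<lambda>_. borel)) (\<lambda>\<omega>. \<lambda>e\<in>K4_E. w e \<omega>) = K4_space t"
proof -
  interpret prob_space M using w by (simp add: K4_weights_def indep_edge_weights_def)
  have ind: "indep_vars (\<lambda>_. borel) w K4_E" using w by (simp add: K4_weights_def indep_edge_weights_def)
  have rv: "w e \<in> borel_measurable M" if "e \<in> K4_E" for e
    using ind that by (simp add: indep_vars_def)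
  then show "(\<lambda>\<omega>. \<lambda>e\<in>K4_E. w e \<omega>) \<in> measurable M (PiM K4_E (\<lambda>_. borel))"
    by (intro measurable_restrict) auto
  have "K4_E \<noteq> {}" by (simp add: K4_E_eq)
  have law: "distr M borel (w e) = power_law (K4_exponent t e)" if e: "e \<in> K4_E" for e
  proof (cases "e \<in> {ab, cd}")
    case True
    have rd: "real_distribution (distr M borel (w e))"
      by (rule real_distribution_distr) (rule rv[OF e])
    then interpret D: real_distribution "distr M borel (w e)" .
    have unit: "cdf (distr M borel (w e)) x = x ^ t" if "0 \<le> x" "x \<le> 1" for x
      using w True that by (auto simp: K4_weights_def)
    have "cdf (distr M borel (w e)) x = (max 0 (min 1 x)) ^ t" for x
    proof -
      \<comment> \<open>Only the values on the unit interval are given; 0 at 0 and 1 at 1 settle the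
        others by monotonicity.\<close>
      consider "x < 0" | "0 \<le> x" "x \<le> 1" | "1 < x" by linarith
      then show ?thesis
      proof cases
        case 1
        have "cdf (distr M borel (w e)) x \<le> cdf (distr M borel (w e)) 0"
          using 1 by (intro D.cdf_nondecreasing) simp
        also have "\<dots> = 0" using unit[of 0] t by simp
        finally have "cdf (distr M borel (w e)) x = 0" using D.cdf_nonneg[of x] by simp
        then show ?thesis using 1 t by simp
      next
        case 2
        then show ?thesis using unit by simp
      next
        case 3
        have "cdf (distr M borel (w e)) 1 \<le> cdf (distr M borel (w e)) x"
          using 3 by (intro D.cdf_nondecreasing) simp
        then have "cdf (distr M borel (w e)) x = 1"
          using unit[of 1] D.cdf_bounded_prob[of x] by simp
        then show ?thesis using 3 by simp
      qed
    qed
    then have "distr M borel (w e) = power_law t"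
      using rd real_distribution_power_law[OF t] by (intro cdf_unique) (auto simp: cdf_power_law[OF t])
    then show ?thesis using True by (simp add: K4_exponent_def)
  next
    case False
    then show ?thesis using w e by (simp add: K4_weights_def K4_exponent_def unif01_eq_power_law)
  qed
  have "distr M (PiM K4_E (\<lambda>_. borel)) (\<lambda>\<omega>. \<lambda>e\<in>K4_E. w e \<omega>) = PiM K4_E (\<lambda>e. distr M borel (w e))"
    using indep_vars_iff_distr_eq_PiM'[OF \<open>K4_E \<noteq> {}\<close> rv] ind by simp
  also have "\<dots> = K4_space t"
    unfolding K4_space_eq by (intro PiM_cong law refl)
  finally show "distr M (PiM K4_E (\<lambda>_. borel)) (\<lambda>\<omega>. \<lambda>e\<in>K4_E. w e \<omega>) = K4_space t" .
qed

lemma distr_K4_space_coordinate: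
  assumes "t \<ge> 1" "e \<in> K4_E"
  shows "distr (K4_space t) borel (\<lambda>\<omega>. \<omega> e) = power_law (K4_exponent t e)"
proof -
  have "distr (K4_space t) borel (\<lambda>\<omega>. \<omega> e) = distr (K4_space t) (power_law (K4_exponent t e)) (\<lambda>\<omega>. \<omega> e)"
    by (rule distr_cong) auto
  also have "\<dots> = power_law (K4_exponent t e)"
    unfolding K4_space_eq
    by (intro distr_PiM_component prob_space_power_law K4_exponent_ge_1 assms)
  finally show ?thesis .
qed

lemma K4_weights_coordinates:
  assumes t: "t \<ge> 1"
  shows "K4_weights t (K4_space t) (\<lambda>e \<omega>. \<omega> e)"
proof -
  interpret prob_space "K4_space t" using t by (rule prob_space_K4_space)
  have rv: "(\<lambda>\<omega>. \<omega> e) \<in> borel_measurable (K4_space t)" if "e \<in> K4_E" for e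
    unfolding measurable_cong_sets[OF sets_K4_space refl] using that by measurable
  note law = distr_K4_space_coordinate[OF t]
  have "K4_E \<noteq> {}" by (simp add: K4_E_eq)
  \<comment> \<open>Points of the product are extensional, so the restriction is the identity map
    and the joint law of the coordinates is \<open>K4_space t\<close> itself.\<close>
  have "distr (K4_space t) (PiM K4_E (\<lambda>_. borel)) (\<lambda>\<omega>. \<lambda>e\<in>K4_E. \<omega> e)
      = distr (K4_space t) (K4_space t) (\<lambda>\<omega>. \<omega>)"
    using sets_eq_imp_space_eq[OF sets_K4_space]
    by (intro distr_cong) (auto simp: sets_K4_space space_PiM PiE_iff extensional_restrict)
  also have "\<dots> = K4_space t" by (rule distr_id)
  also have "\<dots> = PiM K4_E (\<lambda>e. distr (K4_space t) borel (\<lambda>\<omega>. \<omega> e))"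
    unfolding K4_space_eq[of t, symmetric] by (subst K4_space_eq) (intro PiM_cong law[symmetric] refl)
  finally have "indep_vars (\<lambda>_. borel) (\<lambda>e \<omega>. \<omega> e) K4_E"
    using indep_vars_iff_distr_eq_PiM'[OF \<open>K4_E \<noteq> {}\<close> rv] by simp
  moreover have "ab \<in> K4_E" "cd \<in> K4_E" by (simp_all add: K4_E_eq ab_def cd_def)
  ultimately show ?thesis
    unfolding K4_weights_def indep_edge_weights_def
    by (auto simp: law K4_exponent_def cdf_power_law[OF t] unif01_eq_power_law prob_space_axioms)
qed

lemma K4_weights_AE_ex1_mst:
  assumes "t \<ge> 1" "K4_weights t M w"
  shows "AE \<omega> in M. \<exists>!T. is_mst K4_V K4_E (\<lambda>e. w e \<omega>) T"
proof -
  have "AE \<omega> in M. \<exists>!T. is_mst K4_V K4_E (\<lambda>e\<in>K4_E. w e \<omega>) T"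
    using AE_K4_space_ex1_mst[OF assms(1)]
    unfolding K4_weights_distr[OF assms, symmetric]
    by (rule AE_distrD[OF K4_weights_measurable[OF assms]])
  then show ?thesis by (simp only: is_mst_restrict)
qed

text \<open>\<open>Q\<close> is arbitrary so that the joint event and both single events are
  transferred by the same lemma.\<close>

lemma K4_weights_prob_mst:
  assumes "t \<ge> 1" "K4_weights t M w"
  shows "\<P>(\<omega> in M. Q (mst K4_V K4_E (\<lambda>e. w e \<omega>))) = \<P>(\<omega> in K4_space t. Q (mst K4_V K4_E \<omega>))"
proof -
  let ?N = "PiM K4_E (\<lambda>_. borel :: real measure)"
  let ?f = "\<lambda>\<omega>. \<lambda>e\<in>K4_E. w e \<omega>"
  have sp: "space (K4_space t) = space ?N" using sets_K4_space by (rule sets_eq_imp_space_eq)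
  have "{\<omega> \<in> space ?N. Q (mst K4_V K4_E \<omega>)} \<in> sets ?N"
    using measurable_pred_mst[OF simple_graph_K4, of Q] by measurable
  then have "\<P>(\<omega> in K4_space t. Q (mst K4_V K4_E \<omega>))
      = measure M (?f -` {\<omega> \<in> space ?N. Q (mst K4_V K4_E \<omega>)} \<inter> space M)"
    unfolding sp by (subst K4_weights_distr[OF assms, symmetric])
      (rule measure_distr[OF K4_weights_measurable[OF assms]])
  also have "?f -` {\<omega> \<in> space ?N. Q (mst K4_V K4_E \<omega>)} \<inter> space M
      = {\<omega> \<in> space M. Q (mst K4_V K4_E (\<lambda>e. w e \<omega>))}"
    using measurable_space[OF K4_weights_measurable[OF assms]] by (auto simp: mst_restrict)
  finally show ?thesis ..
qed

subsection \<open>Iterated integrals\<close>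

text \<open>Fubini in two stages: the coordinates in \<open>K\<close> are averaged out with those at
  \<open>e\<close> and \<open>f\<close> held fixed, and then these two are separated.\<close>

lemma (in product_sigma_finite) product_integral_insert_pair:
  fixes g :: "('i \<Rightarrow> 'a) \<Rightarrow> real"
  assumes K: "finite K" "e \<notin> K" "f \<notin> K" "e \<noteq> f"
    and g: "integrable (PiM (insert e (insert f K)) M) g"
    and H: "\<And>x z. x \<in> space (M e) \<Longrightarrow> z \<in> space (M f) \<Longrightarrow>
      (\<integral>y. g (y(e := x, f := z)) \<partial>PiM K M) = H x z"
    and H_meas: "(\<lambda>(x, z). H x z) \<in> borel_measurable (M e \<Otimes>\<^sub>M M f)"
  shows "integral\<^sup>L (PiM (insert e (insert f K)) M) g = (\<integral>x. (\<integral>z. H x z \<partial>M f) \<partial>M e)"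
proof -
  have ef: "finite {e, f}" "{e, f} \<inter> K = {}" "insert e (insert f K) = {e, f} \<union> K" using K by auto
  interpret I: finite_product_sigma_finite M "{e, f}" by standard fact
  interpret J: finite_product_sigma_finite M K by standard fact
  interpret P: pair_sigma_finite "PiM {e, f} M" "PiM K M" ..
  have inner: "(\<integral>\<omega>. g (merge {e, f} K (u, \<omega>)) \<partial>PiM K M) = H (u e) (u f)"
    if "u \<in> space (PiM {e, f} M)" for u
  proof -
    have "merge {e, f} K (u, y) = y(e := u e, f := u f)" if "y \<in> space (PiM K M)" for y
      using that K by (auto simp: merge_def space_PiM PiE_iff extensional_def)
    then have "(\<integral>\<omega>. g (merge {e, f} K (u, \<omega>)) \<partial>PiM K M)
        = (\<integral>y. g (y(e := u e, f := u f)) \<partial>PiM K M)"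
      by (intro Bochner_Integration.integral_cong) auto
    also have "\<dots> = H (u e) (u f)" using that by (intro H) (auto simp: space_PiM)
    finally show ?thesis .
  qed
  have "integrable (PiM {e, f} M \<Otimes>\<^sub>M PiM K M) (\<lambda>x. g (merge {e, f} K x))"
  proof (rule integrable_distr[OF measurable_merge])
    show "integrable (distr (PiM {e, f} M \<Otimes>\<^sub>M PiM K M) (PiM ({e, f} \<union> K) M) (merge {e, f} K)) g"
      unfolding distr_merge[OF ef(2,1) K(1)] using g unfolding ef(3) .
  qed
  then have "integrable (PiM {e, f} M) (\<lambda>u. \<integral>\<omega>. g (merge {e, f} K (u, \<omega>)) \<partial>PiM K M)"
    by (rule P.integrable_fst')
  \<comment> \<open>The pair is written with \<open>f\<close> inserted last, so that peeling it off
    leaves \<open>e\<close> as the outer variable.\<close>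
  then have int: "integrable (PiM (insert f {e}) M) (\<lambda>u. H (u e) (u f))"
    by (subst (asm) Bochner_Integration.integrable_cong[OF refl inner]) (simp_all add: insert_commute)
  have "integral\<^sup>L (PiM (insert e (insert f K)) M) g
      = (\<integral>u. (\<integral>\<omega>. g (merge {e, f} K (u, \<omega>)) \<partial>PiM K M) \<partial>PiM {e, f} M)"
    using g unfolding ef(3) by (intro product_integral_fold ef K)
  also have "\<dots> = (\<integral>u. H (u e) (u f) \<partial>PiM (insert f {e}) M)"
    by (subst Bochner_Integration.integral_cong[OF refl inner]) (simp_all add: insert_commute)
  also have "\<dots> = (\<integral>u. (\<integral>z. H (u e) z \<partial>M f) \<partial>PiM {e} M)"
    using K int by (subst product_integral_insert) auto
  also have "\<dots> = (\<integral>x. (\<integral>z. H x z \<partial>M f) \<partial>M e)"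
    by (intro product_integral_singleton H_meas
        sigma_finite_measure.borel_measurable_lebesgue_integral[OF sigma_finite_measures])
  finally show ?thesis .
qed

text \<open>The integrands below depend on finitely many comparisons; treating them as simple
  functions yields measurability and integrability together.\<close>

lemma simple_function_pred:
  assumes "Measurable.pred M P"
  shows "simple_function M P"
  unfolding simple_function_def
proof safe
  show "finite (P ` space M)" by (rule finite_subset[OF subset_UNIV]) simp
  show "P -` {P x} \<inter> space M \<in> sets M" for x
    using assms by (rule measurable_sets) simp
qed

section \<open>Averages over uniform variables compared with two thresholds\<close>

definition clamp01 :: "real \<Rightarrow> real" where
  "clamp01 x = max 0 (min 1 x)"

lemma measure_unif_less: "measure (power_law 1) {..<s} = clamp01 s"
proof -
  interpret prob_space "power_law 1" by (rule prob_space_power_law) simp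
  have "measure (power_law 1) {..<s} = measure (power_law 1) {..s}"
    using AE_power_law_neq[OF order_refl, of s]
    by (intro finite_measure_eq_AE) (auto elim!: eventually_mono)
  also have "\<dots> = clamp01 s"
    using fun_cong[OF cdf_power_law[OF order_refl], of s] by (simp add: cdf_def clamp01_def)
  finally show ?thesis .
qed

text \<open>
  The mean of \<open>g (y < s) (y < r)\<close> over a uniform \<open>y\<close>, for \<open>0 \<le> s \<le> r \<le> 1\<close>. Clamping the
  thresholds to \<open>[0, 1]\<close> makes the formula valid for all real \<open>s \<le> r\<close>, so that no null sets have
  to be tracked in the iterated integrals.
\<close>

definition cells :: "real \<Rightarrow> real \<Rightarrow> (bool \<Rightarrow> bool \<Rightarrow> real) \<Rightarrow> real" where
  "cells s r g = s * g True True + (r - s) * g False True + (1 - r) * g False False"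

text \<open>Since y < s implies y < r, the integrand telescopes into a constant and two indicator
  functions.\<close>

lemma integral_unif_cells:
  assumes "s \<le> r"
  shows "(\<integral>y. g (y < s) (y < r) \<partial>power_law 1) = cells (clamp01 s) (clamp01 r) g"
proof -
  interpret prob_space "power_law 1" by (rule prob_space_power_law) simp
  have "g (y < s) (y < r) = g False False + (g False True - g False False) * indicator {..<r} y
      + (g True True - g False True) * indicator {..<s} y" for y
    using assms by (auto simp: indicator_def)
  then have "(\<integral>y. g (y < s) (y < r) \<partial>power_law 1)
      = (\<integral>y. g False False + (g False True - g False False) * indicator {..<r} y
      + (g True True - g False True) * indicator {..<s} y \<partial>power_law 1)"
    by (intro Bochner_Integration.integral_cong refl)
  also have "\<dots> = g False False + (g False True - g False False) * measure (power_law 1) {..<r}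
        + (g True True - g False True) * measure (power_law 1) {..<s}"
    using prob_space by (simp add: less_top[symmetric] del: One_nat_def)
  also have "\<dots> = cells (clamp01 s) (clamp01 r) g"
    unfolding measure_unif_less cells_def by (simp add: algebra_simps)
  finally show ?thesis .
qed

lemma (in finite_measure) integrable_simple_function:
  fixes g :: "'a \<Rightarrow> real"
  assumes "simple_function M g"
  shows "integrable M g"
proof -
  have "finite (g ` space M)" using assms by (simp add: simple_function_def)
  then have "\<bar>g x\<bar> \<le> Max (abs ` g ` space M)" if "x \<in> space M" for x
    using that by (intro Max_ge) auto
  then show ?thesis
    using borel_measurable_simple_function[OF assms]
    by (intro integrable_const_bound[where B = "Max (abs ` g ` space M)"]) auto
qed

text \<open>Each coordinate enters only through its two comparisons, so averaging one out leaves an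
  integrand of the same kind in fewer coordinates.\<close>

lemma integral_PiM4_unif_cells:
  fixes s r :: real and G :: "bool \<Rightarrow> bool \<Rightarrow> bool \<Rightarrow> bool \<Rightarrow> bool \<Rightarrow> bool \<Rightarrow> bool \<Rightarrow> bool \<Rightarrow> real"
  defines "C \<equiv> cells (clamp01 s) (clamp01 r)"
  assumes sr: "s \<le> r" and dist: "distinct [i, j, k, l]"
  shows "(\<integral>y. G (y i < s) (y i < r) (y j < s) (y j < r) (y k < s) (y k < r) (y l < s) (y l < r)
      \<partial>PiM {i, j, k, l} (\<lambda>_. power_law 1))
    = C (\<lambda>l1 l2. C (\<lambda>k1 k2. C (\<lambda>j1 j2. C (\<lambda>i1 i2. G i1 i2 j1 j2 k1 k2 l1 l2))))"
proof -
  let ?M = "\<lambda>_. power_law 1"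
  interpret product_sigma_finite ?M
    by (rule product_sigma_finite_power_law) simp
  have sf: "simple_function (PiM J ?M) (\<lambda>y. (y m < s, y m < r))" if "m \<in> J" for J m
    using that by (intro simple_function_Pair simple_function_pred) measurable
  have ne: "i \<noteq> j" "i \<noteq> k" "i \<noteq> l" "j \<noteq> k" "j \<noteq> l" "k \<noteq> l"
    "j \<noteq> i" "k \<noteq> i" "l \<noteq> i" "k \<noteq> j" "l \<noteq> j" "l \<noteq> k" using dist by auto
  have insert: "(\<integral>y. F y \<partial>PiM (insert m J) ?M) = (\<integral>y. (\<integral>x. F (y(m := x)) \<partial>power_law 1) \<partial>PiM J ?M)"
    if "finite J" "m \<notin> J" "simple_function (PiM (insert m J) ?M) F" for J m and F :: "('a \<Rightarrow> real) \<Rightarrow> real"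
  proof (rule product_integral_insert[OF that(1,2)])
    interpret prob_space "PiM (insert m J) ?M" by (rule prob_space_PiM_power_law) simp
    show "integrable (PiM (insert m J) ?M) F" using that(3) by (rule integrable_simple_function)
  qed
  \<comment> \<open>Facts 1 to 3 are stated for arbitrary \<open>g\<close>, because they are applied
    to what remains after the previous coordinate has been averaged out.\<close>
  have 1: "(\<integral>y. g (y l < s) (y l < r) \<partial>PiM {l} ?M) = C g" for g
    unfolding C_def integral_unif_cells[OF sr, symmetric]
    using product_integral_singleton[of "\<lambda>x. g (x < s) (x < r)" l]
      borel_measurable_simple_function[OF simple_function_compose2[where h = g]]
    by (simp add: simple_function_pred)
  have 2: "(\<integral>y. g (y k < s) (y k < r) (y l < s) (y l < r) \<partial>PiM {k, l} ?M)
      = C (\<lambda>l1 l2. C (\<lambda>k1 k2. g k1 k2 l1 l2))" for g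
  proof -
    have "(\<integral>y. g (y k < s) (y k < r) (y l < s) (y l < r) \<partial>PiM {k, l} ?M)
        = (\<integral>y. (\<integral>x. g (x < s) (x < r) (y l < s) (y l < r) \<partial>power_law 1) \<partial>PiM {l} ?M)"
      using simple_function_compose2[OF sf sf, of k "{k, l}" l "\<lambda>(k1, k2) (l1, l2). g k1 k2 l1 l2"] ne
      by (subst insert) simp_all
    also have "\<dots> = (\<integral>y. C (\<lambda>k1 k2. g k1 k2 (y l < s) (y l < r)) \<partial>PiM {l} ?M)"
      unfolding C_def by (intro Bochner_Integration.integral_cong refl) (rule integral_unif_cells[OF sr])
    also have "\<dots> = C (\<lambda>l1 l2. C (\<lambda>k1 k2. g k1 k2 l1 l2))"
      by (rule 1)
    finally show ?thesis .
  qed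
  have 3: "(\<integral>y. g (y j < s) (y j < r) (y k < s) (y k < r) (y l < s) (y l < r) \<partial>PiM {j, k, l} ?M)
      = C (\<lambda>l1 l2. C (\<lambda>k1 k2. C (\<lambda>j1 j2. g j1 j2 k1 k2 l1 l2)))" for g
  proof -
    have "(\<integral>y. g (y j < s) (y j < r) (y k < s) (y k < r) (y l < s) (y l < r) \<partial>PiM {j, k, l} ?M)
        = (\<integral>y. (\<integral>x. g (x < s) (x < r) (y k < s) (y k < r) (y l < s) (y l < r) \<partial>power_law 1)
            \<partial>PiM {k, l} ?M)"
      using simple_function_compose2[OF sf simple_function_Pair[OF sf sf], of j "{j, k, l}" k l
          "\<lambda>(j1, j2) ((k1, k2), (l1, l2)). g j1 j2 k1 k2 l1 l2"] ne
      by (subst insert) simp_all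
    also have "\<dots> = (\<integral>y. C (\<lambda>j1 j2. g j1 j2 (y k < s) (y k < r) (y l < s) (y l < r)) \<partial>PiM {k, l} ?M)"
      unfolding C_def by (intro Bochner_Integration.integral_cong refl) (rule integral_unif_cells[OF sr])
    also have "\<dots> = C (\<lambda>l1 l2. C (\<lambda>k1 k2. C (\<lambda>j1 j2. g j1 j2 k1 k2 l1 l2)))"
      by (rule 2)
    finally show ?thesis .
  qed
  have "(\<integral>y. G (y i < s) (y i < r) (y j < s) (y j < r) (y k < s) (y k < r) (y l < s) (y l < r)
      \<partial>PiM {i, j, k, l} ?M)
      = (\<integral>y. (\<integral>x. G (x < s) (x < r) (y j < s) (y j < r) (y k < s) (y k < r) (y l < s) (y l < r)
          \<partial>power_law 1) \<partial>PiM {j, k, l} ?M)"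
    using simple_function_compose2[OF simple_function_Pair[OF sf sf] simple_function_Pair[OF sf sf],
        of i "{i, j, k, l}" j k l
        "\<lambda>((i1, i2), (j1, j2)) ((k1, k2), (l1, l2)). G i1 i2 j1 j2 k1 k2 l1 l2"] ne
    by (subst insert) simp_all
  also have "\<dots> = (\<integral>y. C (\<lambda>i1 i2. G i1 i2 (y j < s) (y j < r) (y k < s) (y k < r) (y l < s) (y l < r))
      \<partial>PiM {j, k, l} ?M)"
    unfolding C_def by (intro Bochner_Integration.integral_cong refl) (rule integral_unif_cells[OF sr])
  also have "\<dots> = C (\<lambda>l1 l2. C (\<lambda>k1 k2. C (\<lambda>j1 j2. C (\<lambda>i1 i2. G i1 i2 j1 j2 k1 k2 l1 l2))))"
    by (rule 3)
  finally show ?thesis .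
qed

lemma clamp01_borel [measurable]: "clamp01 \<in> borel_measurable borel"
  unfolding clamp01_def by measurable

section \<open>Moments of the power law\<close>

context
  fixes t :: nat
  assumes t: "t \<ge> 1"
begin

lemma power_law_truncated_moment_clamp:
  "has_bochner_integral (power_law t) (\<lambda>z. clamp01 z ^ k * indicator {..<x} z)
    (real t / real (t + k) * clamp01 x ^ (t + k))"
proof -
  \<comment> \<open>Removing z = 1 handles x > 1, where the original truncation contains this point
    and the clamped one does not.\<close>
  have "AE z in power_law t. clamp01 z ^ k * indicator {..<x} z = z ^ k * indicator {..<clamp01 x} z"
    using AE_power_law_Icc[OF t] AE_power_law_neq[OF t, of 1]
    by eventually_elim (auto simp: clamp01_def indicator_def)
  then have "has_bochner_integral (power_law t) (\<lambda>z. clamp01 z ^ k * indicator {..<x} z)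
      (real t / real (t + k) * clamp01 x ^ (t + k)) \<longleftrightarrow>
    has_bochner_integral (power_law t) (\<lambda>z. z ^ k * indicator {..<clamp01 x} z)
      (real t / real (t + k) * clamp01 x ^ (t + k))"
    by (intro has_bochner_integral_cong_AE) measurable
  then show ?thesis
    using power_law_truncated_moment[OF t, of "clamp01 x" k] by (simp add: clamp01_def)
qed

lemma power_law_moment_clamp:
  "has_bochner_integral (power_law t) (\<lambda>z. clamp01 z ^ k) (real t / real (t + k))"
proof -
  \<comment> \<open>The cut at 2 lies above the support and truncates nothing.\<close>
  have "AE z in power_law t. clamp01 z ^ k = clamp01 z ^ k * indicator {..<2} z"
    using AE_power_law_Icc[OF t] by eventually_elim (auto simp: indicator_def)
  then have "has_bochner_integral (power_law t) (\<lambda>z. clamp01 z ^ k) (real t / real (t + k)) \<longleftrightarrow>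
    has_bochner_integral (power_law t) (\<lambda>z. clamp01 z ^ k * indicator {..<2} z) (real t / real (t + k))"
    by (intro has_bochner_integral_cong_AE) measurable
  then show ?thesis
    using power_law_truncated_moment_clamp[of k 2] by (simp add: clamp01_def)
qed

end

text \<open>Abstract labels for two opposite edges \<open>e\<close>, \<open>f\<close> and the four
  uniform ones let a single computation serve both \<open>ab\<close> and \<open>cd\<close>.\<close>

locale K4_product =
  fixes e f i j k l :: 'i and t :: nat and n :: "'i \<Rightarrow> nat"
  assumes t: "t \<ge> 1" and dist: "distinct [e, f, i, j, k, l]"
    and n: "\<And>m. n m = (if m \<in> {e, f} then t else 1)"
begin

abbreviation "law m \<equiv> power_law (n m)"

abbreviation "P \<equiv> PiM {e, f, i, j, k, l} law"

lemma n_ge_1: "n m \<ge> 1"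
  using t by (simp add: n)

sublocale product_sigma_finite law
  by (rule product_sigma_finite_power_law) (rule n_ge_1)

sublocale prob_space P
  by (rule prob_space_PiM_power_law) (rule n_ge_1)

lemma PiM_uniform_part: "PiM {i, j, k, l} law = PiM {i, j, k, l} (\<lambda>_. power_law 1)"
  using dist by (intro PiM_cong) (auto simp: n)

lemma neqs: "e \<noteq> f" "e \<noteq> i" "e \<noteq> j" "e \<noteq> k" "e \<noteq> l" "f \<noteq> i" "f \<noteq> j" "f \<noteq> k" "f \<noteq> l"
  "f \<noteq> e" "i \<noteq> e" "j \<noteq> e" "k \<noteq> e" "l \<noteq> e" "i \<noteq> f" "j \<noteq> f" "k \<noteq> f" "l \<noteq> f" "distinct [i, j, k, l]"
  using dist by auto

text \<open>\<open>H x z\<close> is the conditional probability of \<open>Q\<close> given the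
  weights x and z of \<open>e\<close> and \<open>f\<close>.\<close>

lemma prob_as_iterated_integral:
  fixes H :: "real \<Rightarrow> real \<Rightarrow> real"
  assumes Q: "Measurable.pred P Q"
    and H: "\<And>x z. (\<integral>y. of_bool (Q (y(e := x, f := z))) \<partial>PiM {i, j, k, l} (\<lambda>_. power_law 1)) = H x z"
    and H_meas: "(\<lambda>(x, z). H x z) \<in> borel_measurable (borel \<Otimes>\<^sub>M borel)"
  shows "prob {\<omega> \<in> space P. Q \<omega>} = (\<integral>x. (\<integral>z. H x z \<partial>power_law t) \<partial>power_law t)"
proof -
  have "prob {\<omega> \<in> space P. Q \<omega>} = (\<integral>\<omega>. indicator {\<omega> \<in> space P. Q \<omega>} \<omega> \<partial>P)"
    using Q by simp
  also have "\<dots> = (\<integral>\<omega>. of_bool (Q \<omega>) \<partial>P)"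
    by (intro Bochner_Integration.integral_cong) (auto simp: indicator_def)
  also have "\<dots> = (\<integral>x. (\<integral>z. H x z \<partial>law f) \<partial>law e)"
  proof (rule product_integral_insert_pair)
    have "simple_function P (\<lambda>\<omega>. of_bool (Q \<omega>) :: real)"
      using simple_function_pred[OF Q] by (rule simple_function_compose1)
    then show "integrable P (\<lambda>\<omega>. of_bool (Q \<omega>) :: real)" by (rule integrable_simple_function)
    show "(\<lambda>(x, z). H x z) \<in> borel_measurable (law e \<Otimes>\<^sub>M law f)"
      using H_meas by (simp cong: measurable_cong_sets sets_pair_measure_cong)
  qed (use neqs H in \<open>auto simp: PiM_uniform_part\<close>)
  finally show ?thesis by (simp add: n)
qed

text \<open>Let u be the weight of \<open>e\<close>. If \<open>f\<close> is not lighter, both paths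
  of length two must be broken, each with probability 1 - u^2, which gives \<open>?A\<close>. If
  \<open>f\<close> is lighter, some end of \<open>e\<close> must have no lighter uniform edge; each
  end achieves this independently with probability (1 - u)^2, which gives \<open>?B\<close>.\<close>

lemma prob_separated4:
  "prob {\<omega> \<in> space P. separated4 (\<omega> i < \<omega> e) (\<omega> j < \<omega> e) (\<omega> k < \<omega> e) (\<omega> l < \<omega> e) (\<omega> f < \<omega> e)}
    = 1 - 2 * t / (t + 2) + t / (t + 4) - 2 * t / (2 * t + 2) + 4 * t / (2 * t + 3) - 2 * t / (2 * t + 4)"
proof -
  let ?A = "\<lambda>u :: real. (1 - u\<^sup>2)\<^sup>2" and ?B = "\<lambda>u :: real. 1 - (1 - (1 - u)\<^sup>2)\<^sup>2"
  let ?H = "\<lambda>x z. if z < x then ?B (clamp01 x) else ?A (clamp01 x)"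
  have "prob {\<omega> \<in> space P. separated4 (\<omega> i < \<omega> e) (\<omega> j < \<omega> e) (\<omega> k < \<omega> e) (\<omega> l < \<omega> e) (\<omega> f < \<omega> e)}
      = (\<integral>x. (\<integral>z. ?H x z \<partial>power_law t) \<partial>power_law t)"
  proof (rule prob_as_iterated_integral)
    show "Measurable.pred P
        (\<lambda>\<omega>. separated4 (\<omega> i < \<omega> e) (\<omega> j < \<omega> e) (\<omega> k < \<omega> e) (\<omega> l < \<omega> e) (\<omega> f < \<omega> e))"
      unfolding separated4_def by measurable
    show "(\<integral>y. of_bool (separated4 ((y(e := x, f := z)) i < (y(e := x, f := z)) e)
          ((y(e := x, f := z)) j < (y(e := x, f := z)) e) ((y(e := x, f := z)) k < (y(e := x, f := z)) e)
          ((y(e := x, f := z)) l < (y(e := x, f := z)) e) ((y(e := x, f := z)) f < (y(e := x, f := z)) e))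
        \<partial>PiM {i, j, k, l} (\<lambda>_. power_law 1)) = ?H x z" for x z
      using integral_PiM4_unif_cells[where s = x and r = x
          and G = "\<lambda>i1 i2 j1 j2 k1 k2 l1 l2. of_bool (separated4 i2 j2 k2 l2 (z < x))",
          OF order_refl neqs(19)]
      by (cases "z < x") (simp_all add: neqs cells_def separated4_def power2_eq_square algebra_simps)
  qed measurable
  \<comment> \<open>The factors \<open>1\<close> and the exponent \<open>0\<close> give every term
    the shape required by \<open>power_law_moment_clamp\<close>.\<close>
  also have "\<dots> = (\<integral>x. 1 * clamp01 x ^ 0 - 2 * clamp01 x ^ 2 + 1 * clamp01 x ^ 4 - 2 * clamp01 x ^ (t + 2)
      + 4 * clamp01 x ^ (t + 3) - 2 * clamp01 x ^ (t + 4) \<partial>power_law t)"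
  proof (intro Bochner_Integration.integral_cong refl)
    fix x
    interpret L: prob_space "power_law t" using t by (rule prob_space_power_law)
    let ?u = "clamp01 x"
    have "has_bochner_integral (power_law t) (\<lambda>z. indicator {..<x} z) (?u ^ t)"
      using power_law_truncated_moment_clamp[OF t, of 0 x] t by simp
    moreover have "has_bochner_integral (power_law t) (\<lambda>z. ?A ?u) (?A ?u)"
      using L.prob_space by (simp add: has_bochner_integral_iff)
    ultimately have "has_bochner_integral (power_law t)
        (\<lambda>z. ?A ?u + (?B ?u - ?A ?u) * indicator {..<x} z) (?A ?u + (?B ?u - ?A ?u) * ?u ^ t)"
      by (intro has_bochner_integral_add has_bochner_integral_mult_right)
    moreover have "?A ?u + (?B ?u - ?A ?u) * indicator {..<x} z = ?H x z" for z
      by (simp add: indicator_def)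
    ultimately have "(\<integral>z. ?H x z \<partial>power_law t) = ?A ?u + (?B ?u - ?A ?u) * ?u ^ t"
      by (simp add: has_bochner_integral_iff)
    also have "\<dots> = 1 * ?u ^ 0 - 2 * ?u ^ 2 + 1 * ?u ^ 4 - 2 * ?u ^ (t + 2)
      + 4 * ?u ^ (t + 3) - 2 * ?u ^ (t + 4)"
      by (simp add: power_add algebra_simps power2_eq_square numeral_eq_Suc)
    finally show "(\<integral>z. ?H x z \<partial>power_law t) = 1 * ?u ^ 0 - 2 * ?u ^ 2 + 1 * ?u ^ 4 - 2 * ?u ^ (t + 2)
      + 4 * ?u ^ (t + 3) - 2 * ?u ^ (t + 4)" .
  qed
  also have "\<dots> = 1 * (real t / real (t + 0)) - 2 * (real t / real (t + 2))
      + 1 * (real t / real (t + 4)) - 2 * (real t / real (t + (t + 2)))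
      + 4 * (real t / real (t + (t + 3))) - 2 * (real t / real (t + (t + 4)))"
    by (intro has_bochner_integral_integral_eq has_bochner_integral_add has_bochner_integral_diff
        has_bochner_integral_mult_right power_law_moment_clamp t)
  finally show ?thesis using t by (simp add: algebra_simps)
qed

text \<open>For weights u of \<open>e\<close> and v < u of \<open>f\<close>, one end of
  \<open>e\<close> must have both its uniform edges at least u, and the two at the other end must
  not both be below v, as they form a path joining the ends of \<open>f\<close>. Inclusion-exclusion
  over the choice of the end gives \<open>?K\<close>. The opposite order of the weights is left to
  an exchange of roles.\<close>

lemma prob_separated4_both:
  "prob {\<omega> \<in> space P.
      separated4 (\<omega> i < \<omega> e) (\<omega> j < \<omega> e) (\<omega> k < \<omega> e) (\<omega> l < \<omega> e) (\<omega> f < \<omega> e) \<and>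
      separated4 (\<omega> i < \<omega> f) (\<omega> k < \<omega> f) (\<omega> j < \<omega> f) (\<omega> l < \<omega> f) (\<omega> e < \<omega> f) \<and> \<omega> f < \<omega> e}
    = 1 / 2 - (4 + 2 * (t / (t + 2))) * (t / (2 * t + 2)) + (4 + 4 * (t / (t + 2))) * (t / (2 * t + 3))
      - (1 + 2 * (t / (t + 2))) * (t / (2 * t + 4))"
proof -
  let ?K = "\<lambda>u v :: real. 2 * (1 - u)\<^sup>2 * (1 - v\<^sup>2) - (1 - u) ^ 4"
  let ?H = "\<lambda>x z. if z < x then ?K (clamp01 x) (clamp01 z) else 0"
  let ?c = "real t / real (t + 2)"
  let ?Q = "\<lambda>\<omega>. separated4 (\<omega> i < \<omega> e) (\<omega> j < \<omega> e) (\<omega> k < \<omega> e) (\<omega> l < \<omega> e) (\<omega> f < \<omega> e) \<and>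
      separated4 (\<omega> i < \<omega> f) (\<omega> k < \<omega> f) (\<omega> j < \<omega> f) (\<omega> l < \<omega> f) (\<omega> e < \<omega> f) \<and> \<omega> f < (\<omega> e :: real)"
  have "prob {\<omega> \<in> space P. ?Q \<omega>} = (\<integral>x. (\<integral>z. ?H x z \<partial>power_law t) \<partial>power_law t)"
  proof (rule prob_as_iterated_integral)
    show "Measurable.pred P ?Q"
      unfolding separated4_def by measurable
    show "(\<integral>y. of_bool (?Q (y(e := x, f := z))) \<partial>PiM {i, j, k, l} (\<lambda>_. power_law 1)) = ?H x z" for x z
    proof (cases "z < x")
      case True
      then show ?thesis
        \<comment> \<open>The suffix 1 marks comparison with z and the suffix 2 comparison with x;
          \<open>True\<close> and \<open>False\<close> record that \<open>f\<close> is lighter than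
          \<open>e\<close> and not conversely.\<close>
        using integral_PiM4_unif_cells[where s = z and r = x
            and G = "\<lambda>i1 i2 j1 j2 k1 k2 l1 l2. of_bool (separated4 i2 j2 k2 l2 True \<and> separated4 i1 k1 j1 l1 False)",
            OF less_imp_le[OF True] neqs(19)]
        by (simp add: neqs cells_def separated4_def)
          (simp add: power2_eq_square power4_eq_xxxx algebra_simps)
    qed (simp add: neqs)
  qed measurable
  also have "\<dots> = (\<integral>x. 1 * clamp01 x ^ t - (4 + 2 * ?c) * clamp01 x ^ (t + 2)
      + (4 + 4 * ?c) * clamp01 x ^ (t + 3) - (1 + 2 * ?c) * clamp01 x ^ (t + 4) \<partial>power_law t)"
  proof (intro Bochner_Integration.integral_cong refl)
    fix x
    let ?u = "clamp01 x"
    have "has_bochner_integral (power_law t)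
        (\<lambda>z. (2 * (1 - ?u)\<^sup>2 - (1 - ?u) ^ 4) * (clamp01 z ^ 0 * indicator {..<x} z)
          - 2 * (1 - ?u)\<^sup>2 * (clamp01 z ^ 2 * indicator {..<x} z))
        ((2 * (1 - ?u)\<^sup>2 - (1 - ?u) ^ 4) * (real t / real (t + 0) * ?u ^ (t + 0))
          - 2 * (1 - ?u)\<^sup>2 * (?c * ?u ^ (t + 2)))"
      by (intro has_bochner_integral_diff has_bochner_integral_mult_right
          power_law_truncated_moment_clamp t)
    moreover have "(2 * (1 - ?u)\<^sup>2 - (1 - ?u) ^ 4) * (clamp01 z ^ 0 * indicator {..<x} z)
          - 2 * (1 - ?u)\<^sup>2 * (clamp01 z ^ 2 * indicator {..<x} z) = ?H x z" for z
      by (simp add: indicator_def algebra_simps)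
    ultimately have "(\<integral>z. ?H x z \<partial>power_law t)
      = (2 * (1 - ?u)\<^sup>2 - (1 - ?u) ^ 4) * (real t / real (t + 0) * ?u ^ (t + 0))
          - 2 * (1 - ?u)\<^sup>2 * (?c * ?u ^ (t + 2))"
      by (simp only: has_bochner_integral_iff)
    also have "\<dots> = (2 * (1 - ?u)\<^sup>2 - (1 - ?u) ^ 4) * ?u ^ t - 2 * (1 - ?u)\<^sup>2 * (?c * (?u ^ t * ?u\<^sup>2))"
      using t by (simp add: power_add power2_eq_square)
    also have "\<dots> = 1 * ?u ^ t - (4 + 2 * ?c) * (?u ^ t * ?u\<^sup>2) + (4 + 4 * ?c) * (?u ^ t * ?u ^ 3)
      - (1 + 2 * ?c) * (?u ^ t * ?u ^ 4)"
      by algebra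
    finally show "(\<integral>z. ?H x z \<partial>power_law t) = 1 * ?u ^ t - (4 + 2 * ?c) * ?u ^ (t + 2)
      + (4 + 4 * ?c) * ?u ^ (t + 3) - (1 + 2 * ?c) * ?u ^ (t + 4)"
      by (simp only: power_add)
  qed
  also have "\<dots> = 1 * (real t / real (t + t)) - (4 + 2 * ?c) * (real t / real (t + (t + 2)))
      + (4 + 4 * ?c) * (real t / real (t + (t + 3))) - (1 + 2 * ?c) * (real t / real (t + (t + 4)))"
    by (intro has_bochner_integral_integral_eq has_bochner_integral_add has_bochner_integral_diff
        has_bochner_integral_mult_right power_law_moment_clamp t)
  finally show ?thesis using t by (simp add: algebra_simps)
qed

end

subsection \<open>Probabilities in the minimum spanning tree\<close>

lemma K4_E_split:
  "{ab, cd, {0, 2}, {1, 2}, {0, 3}, {1, 3}} = K4_E"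
  "{cd, ab, {0, 2}, {0, 3}, {1, 2}, {1, 3}} = K4_E"
  unfolding K4_E_eq ab_def cd_def by (simp_all only: insert_commute)

lemma K4_edges_distinct:
  "distinct [ab, cd, {0, 2}, {1, 2}, {0, 3}, {1, 3}]" "distinct [cd, ab, {0, 2}, {0, 3}, {1, 2}, {1, 3}]"
  by (simp_all add: ab_def cd_def doubleton_eq_iff)

definition ab_event :: "(nat set \<Rightarrow> real) \<Rightarrow> bool" where
  "ab_event \<omega> \<longleftrightarrow> separated4 (\<omega> {0, 2} < \<omega> ab) (\<omega> {1, 2} < \<omega> ab) (\<omega> {0, 3} < \<omega> ab)
     (\<omega> {1, 3} < \<omega> ab) (\<omega> cd < \<omega> ab)"

definition cd_event :: "(nat set \<Rightarrow> real) \<Rightarrow> bool" where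
  "cd_event \<omega> \<longleftrightarrow> separated4 (\<omega> {0, 2} < \<omega> cd) (\<omega> {0, 3} < \<omega> cd) (\<omega> {1, 2} < \<omega> cd)
     (\<omega> {1, 3} < \<omega> cd) (\<omega> ab < \<omega> cd)"

context
  fixes t :: nat
  assumes t: "t \<ge> 1"
begin

interpretation prob_space "K4_space t"
  using t by (rule prob_space_K4_space)

interpretation A: K4_product ab cd "{0, 2}" "{1, 2}" "{0, 3}" "{1, 3}" t "K4_exponent t"
  using t K4_edges_distinct(1) by (simp add: K4_product_def K4_exponent_def)

text \<open>Besides \<open>ab\<close> and \<open>cd\<close>, the labels \<open>{0, 3}\<close> and
  \<open>{1, 2}\<close> are exchanged, in agreement with \<open>cd_mem_mst_K4_iff\<close>.\<close>

interpretation B: K4_product cd ab "{0, 2}" "{0, 3}" "{1, 2}" "{1, 3}" t "K4_exponent t"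
  using t K4_edges_distinct(2) by (simp add: K4_product_def K4_exponent_def insert_commute)

lemma measurable_K4_mst [measurable]: "Measurable.pred (K4_space t) (\<lambda>\<omega>. Q (mst K4_V K4_E \<omega>))"
  unfolding measurable_cong_sets[OF sets_K4_space refl]
  by (rule measurable_pred_mst[OF simple_graph_K4])

lemma measurable_K4_coordinates [measurable]:
  "(\<lambda>\<omega>. \<omega> ab) \<in> borel_measurable (K4_space t)"
  "(\<lambda>\<omega>. \<omega> cd) \<in> borel_measurable (K4_space t)"
  "(\<lambda>\<omega>. \<omega> {0, 2}) \<in> borel_measurable (K4_space t)"
  "(\<lambda>\<omega>. \<omega> {1, 2}) \<in> borel_measurable (K4_space t)"
  "(\<lambda>\<omega>. \<omega> {0, 3}) \<in> borel_measurable (K4_space t)"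
  "(\<lambda>\<omega>. \<omega> {1, 3}) \<in> borel_measurable (K4_space t)"
  unfolding measurable_cong_sets[OF sets_K4_space refl]
  by (rule measurable_component_singleton, simp add: K4_E_eq ab_def cd_def)+

lemma measurable_K4_events [measurable]:
  "Measurable.pred (K4_space t) ab_event" "Measurable.pred (K4_space t) cd_event"
  unfolding ab_event_def[abs_def] cd_event_def[abs_def] separated4_def by measurable

text \<open>Almost surely the weights are nonnegative and distinct, and there the deterministic
  criteria apply.\<close>

lemma AE_K4_mst_events:
  "AE \<omega> in K4_space t. (ab \<in> mst K4_V K4_E \<omega> \<longleftrightarrow> ab_event \<omega>) \<and> (cd \<in> mst K4_V K4_E \<omega> \<longleftrightarrow> cd_event \<omega>)
    \<and> \<omega> ab \<noteq> \<omega> cd"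
  using AE_K4_space[OF t]
proof eventually_elim
  case (elim \<omega>)
  then have nonneg: "\<forall>e\<in>K4_E. 0 \<le> \<omega> e" and inj: "inj_on \<omega> K4_E" by auto
  have "ab \<noteq> cd" using K4_edges_distinct(1) by simp
  moreover have "ab \<in> K4_E" "cd \<in> K4_E" by (simp_all add: K4_E_eq ab_def cd_def)
  ultimately have "\<omega> ab \<noteq> \<omega> cd" using inj by (simp add: inj_on_eq_iff)
  then show ?case
    unfolding ab_event_def cd_event_def
    using ab_mem_mst_K4_iff[OF nonneg inj] cd_mem_mst_K4_iff[OF nonneg inj] by simp
qed

lemma K4_prob_single_closed_form:
  "1 - 2 * t / (t + 2) + t / (t + 4) - 2 * t / (2 * t + 2) + 4 * t / (2 * t + 3) - 2 * t / (2 * t + 4)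
    = 3 * (5 * (real t)\<^sup>2 + 12 * real t + 8)
      / ((real t + 1) * (real t + 2) * (real t + 4) * (2 * real t + 3))"
proof -
  have "real t + 1 > 0" "real t + 2 > 0" "real t + 4 > 0" "2 * real t + 3 > 0"
    "2 * real t + 2 = 2 * (real t + 1)" "2 * real t + 4 = 2 * (real t + 2)" by auto
  then show ?thesis by (simp add: divide_simps) algebra
qed

lemma K4_prob_both_closed_form:
  "2 * (1 / 2 - (4 + 2 * (t / (t + 2))) * (t / (2 * t + 2)) + (4 + 4 * (t / (t + 2))) * (t / (2 * t + 3))
      - (1 + 2 * (t / (t + 2))) * (t / (2 * t + 4)))
    = 2 * (5 * real t + 6) / ((real t + 1) * (real t + 2)\<^sup>2 * (2 * real t + 3))"
proof -
  have "real t + 1 > 0" "real t + 2 > 0" "2 * real t + 3 > 0"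
    "2 * real t + 2 = 2 * (real t + 1)" "2 * real t + 4 = 2 * (real t + 2)" by auto
  then show ?thesis by (simp add: divide_simps) algebra
qed

lemma K4_prob_ab:
  "prob {\<omega> \<in> space (K4_space t). ab \<in> mst K4_V K4_E \<omega>}
    = 3 * (5 * (real t)\<^sup>2 + 12 * real t + 8)
      / ((real t + 1) * (real t + 2) * (real t + 4) * (2 * real t + 3))"
proof -
  have "prob {\<omega> \<in> space (K4_space t). ab \<in> mst K4_V K4_E \<omega>} = prob {\<omega> \<in> space (K4_space t). ab_event \<omega>}"
    using AE_K4_mst_events by (intro finite_measure_eq_AE) (auto elim!: eventually_mono)
  also note A.prob_separated4[unfolded K4_E_split K4_space_eq[symmetric], folded ab_event_def]
  finally show ?thesis by (simp only: K4_prob_single_closed_form)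
qed

lemma K4_prob_cd:
  "prob {\<omega> \<in> space (K4_space t). cd \<in> mst K4_V K4_E \<omega>}
    = 3 * (5 * (real t)\<^sup>2 + 12 * real t + 8)
      / ((real t + 1) * (real t + 2) * (real t + 4) * (2 * real t + 3))"
proof -
  have "prob {\<omega> \<in> space (K4_space t). cd \<in> mst K4_V K4_E \<omega>} = prob {\<omega> \<in> space (K4_space t). cd_event \<omega>}"
    using AE_K4_mst_events by (intro finite_measure_eq_AE) (auto elim!: eventually_mono)
  also note B.prob_separated4[unfolded K4_E_split K4_space_eq[symmetric], folded cd_event_def]
  finally show ?thesis by (simp only: K4_prob_single_closed_form)
qed

text \<open>As ties are null, the event splits according to which of the two edges is lighter; the
  instances \<open>A\<close> and \<open>B\<close> give both parts the same probability.\<close>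

lemma K4_prob_both:
  "prob {\<omega> \<in> space (K4_space t). ab \<in> mst K4_V K4_E \<omega> \<and> cd \<in> mst K4_V K4_E \<omega>}
    = 2 * (5 * real t + 6) / ((real t + 1) * (real t + 2)\<^sup>2 * (2 * real t + 3))"
proof -
  let ?S = "space (K4_space t)"
  let ?E1 = "{\<omega> \<in> ?S. ab_event \<omega> \<and> cd_event \<omega> \<and> \<omega> cd < \<omega> ab}"
  let ?E2 = "{\<omega> \<in> ?S. cd_event \<omega> \<and> ab_event \<omega> \<and> \<omega> ab < \<omega> cd}"
  have E: "?E1 \<in> events" "?E2 \<in> events" by measurable
  have "{\<omega> \<in> ?S. ab \<in> mst K4_V K4_E \<omega> \<and> cd \<in> mst K4_V K4_E \<omega>} \<in> events"
    using measurable_K4_mst[of "\<lambda>T. ab \<in> T \<and> cd \<in> T"] by measurable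
  moreover have "AE \<omega> in K4_space t.
      \<omega> \<in> {\<omega> \<in> ?S. ab \<in> mst K4_V K4_E \<omega> \<and> cd \<in> mst K4_V K4_E \<omega>} \<longleftrightarrow> \<omega> \<in> ?E1 \<union> ?E2"
    using AE_K4_mst_events by eventually_elim auto
  ultimately have "prob {\<omega> \<in> ?S. ab \<in> mst K4_V K4_E \<omega> \<and> cd \<in> mst K4_V K4_E \<omega>} = prob (?E1 \<union> ?E2)"
    using E by (intro finite_measure_eq_AE) auto
  also have "\<dots> = prob ?E1 + prob ?E2"
    using E by (intro finite_measure_Union) auto
  also note A.prob_separated4_both[unfolded K4_E_split K4_space_eq[symmetric],
      folded ab_event_def cd_event_def]
  also note B.prob_separated4_both[unfolded K4_E_split K4_space_eq[symmetric],
      folded ab_event_def cd_event_def]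
  finally show ?thesis by (simp only: mult_2[symmetric] K4_prob_both_closed_form)
qed

lemma R_eq:
  "R t = 2 * (5 * real t + 6) * (real t + 1) * (real t + 4)\<^sup>2 * (2 * real t + 3)
    / (9 * (5 * (real t)\<^sup>2 + 12 * real t + 8)\<^sup>2)"
proof -
  have "real t + 1 > 0" "real t + 2 > 0" "real t + 4 > 0" "2 * real t + 3 > 0" by auto
  moreover have "5 * (real t)\<^sup>2 + 12 * real t + 8 > 0"
    by (intro add_nonneg_pos) auto
  ultimately show ?thesis
    unfolding R_def mst_ratio_def Let_def K4_prob_ab K4_prob_cd K4_prob_both
    by (simp add: divide_simps) (simp add: power2_eq_square algebra_simps)
qed

end

subsection \<open>The ratio as a rational function\<close>

lemma K4_denominator_pos: "x \<ge> 0 \<Longrightarrow> 5 * x\<^sup>2 + 12 * x + 8 > (0 :: real)"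
  by (intro add_nonneg_pos) auto

lemma R_less_Suc:
  assumes "t \<ge> 1"
  shows "R t < R (Suc t)"
proof -
  \<comment> \<open>In terms of y = t - 1 the cross-multiplied difference has only positive
    coefficients, so its sign is evident for y >= 0.\<close>
  define y where "y = real t - 1"
  have y: "y \<ge> 0" and t: "real t = y + 1" "real (Suc t) = y + 2" using assms by (simp_all add: y_def)
  let ?N = "\<lambda>x :: real. 2 * (5 * x + 6) * (x + 1) * (x + 4)\<^sup>2 * (2 * x + 3)"
  let ?D = "\<lambda>x :: real. 9 * (5 * x\<^sup>2 + 12 * x + 8)\<^sup>2"
  have "?N (y + 2) * ?D (y + 1) - ?N (y + 1) * ?D (y + 2)
      = 18 * (250 * y ^ 8 + 5400 * y ^ 7 + 48935 * y ^ 6 + 242311 * y ^ 5 + 712831 * y ^ 4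
        + 1262269 * y ^ 3 + 1289264 * y\<^sup>2 + 669300 * y + 124000)"
    by algebra
  also have "\<dots> > 0" using y by (intro mult_pos_pos add_nonneg_pos add_nonneg_nonneg) auto
  finally have "?N (y + 1) * ?D (y + 2) < ?N (y + 2) * ?D (y + 1)" by simp
  moreover have "?D (y + 1) > 0" "?D (y + 2) > 0"
    using K4_denominator_pos[of "y + 1"] K4_denominator_pos[of "y + 2"] y by simp_all
  ultimately have "?N (y + 1) / ?D (y + 1) < ?N (y + 2) / ?D (y + 2)"
    by (simp only: frac_less_eq pos_divide_less_eq pos_less_divide_eq times_divide_eq_left)
  then show ?thesis using assms by (simp only: R_eq t le_SucI)
qed

lemma strict_mono_on_R: "strict_mono_on {1..} R"
proof (rule strict_mono_onI)
  fix s t :: nat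
  assume "s \<in> {1..}" "t \<in> {1..}" "s < t"
  then show "R s < R t"
  proof (induction t)
    case (Suc t)
    then show ?case
      using R_less_Suc[of t] by (cases "s = t") (force intro: less_trans)+
  qed simp
qed

lemma R_asymptotics: "(\<lambda>t. R t - (4 * real t / 45 + 46 / 75)) \<in> O(\<lambda>t. 1 / real t)"
proof -
  have "(\<lambda>t. 2 * (5 * real t + 6) * (real t + 1) * (real t + 4)\<^sup>2 * (2 * real t + 3)
      / (9 * (5 * (real t)\<^sup>2 + 12 * real t + 8)\<^sup>2) - (4 * real t / 45 + 46 / 75)) \<in> O(\<lambda>t. 1 / real t)"
    by real_asymp
  \<comment> \<open>The closed form is available from t = 1 on, which suffices for an asymptotic
    statement.\<close>
  moreover have "\<forall>\<^sub>F t in sequentially. R t - (4 * real t / 45 + 46 / 75)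
      = 2 * (5 * real t + 6) * (real t + 1) * (real t + 4)\<^sup>2 * (2 * real t + 3)
      / (9 * (5 * (real t)\<^sup>2 + 12 * real t + 8)\<^sup>2) - (4 * real t / 45 + 46 / 75)"
    using eventually_ge_at_top[of 1] by eventually_elim (simp add: R_eq)
  ultimately show ?thesis by (subst landau_o.big.in_cong)
qed

lemma R_at_top: "filterlim R at_top sequentially"
proof -
  have "filterlim (\<lambda>t. 2 * (5 * real t + 6) * (real t + 1) * (real t + 4)\<^sup>2 * (2 * real t + 3)
      / (9 * (5 * (real t)\<^sup>2 + 12 * real t + 8)\<^sup>2)) at_top sequentially"
    by real_asymp
  moreover have "\<forall>\<^sub>F t in sequentially. R t
      = 2 * (5 * real t + 6) * (real t + 1) * (real t + 4)\<^sup>2 * (2 * real t + 3)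
      / (9 * (5 * (real t)\<^sup>2 + 12 * real t + 8)\<^sup>2)"
    using eventually_ge_at_top[of 1] by eventually_elim (simp add: R_eq)
  ultimately show ?thesis by (subst filterlim_cong[OF refl refl])
qed

text \<open>Monotonicity leaves only the evaluation at 83.\<close>

lemma R_le_8:
  assumes "t \<in> {1..<84}"
  shows "R t \<le> 8"
proof -
  have "R t \<le> R 83"
    using assms strict_mono_on_leD[OF strict_mono_on_R, of t 83] by simp
  also have "R 83 \<le> 8" by (simp add: R_eq)
  finally show ?thesis .
qed

section \<open>Failure of a uniform constant\<close>

lemma K4_atomless:
  assumes t: "t \<ge> 1"
  shows "atomless_edge_weights (K4_space t) K4_E (\<lambda>e \<omega>. \<omega> e)"
  unfolding atomless_edge_weights_def
proof (intro ballI allI)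
  fix e x
  assume e: "e \<in> K4_E"
  interpret L: prob_space "power_law (K4_exponent t e)"
    by (intro prob_space_power_law K4_exponent_ge_1 t)
  have "measure (distr (K4_space t) borel (\<lambda>\<omega>. \<omega> e)) {x} = measure (power_law (K4_exponent t e)) {x}"
    by (simp only: distr_K4_space_coordinate[OF t e])
  also have "\<dots> = measure (power_law (K4_exponent t e)) {}"
    using AE_power_law_neq[OF K4_exponent_ge_1[OF t], of x e]
    by (intro L.finite_measure_eq_AE) (auto elim!: eventually_mono)
  finally show "measure (distr (K4_space t) borel (\<lambda>\<omega>. \<omega> e)) {x} = 0" by simp
qed

lemma mst_ratio_unbounded:
  "\<not> (\<exists>C :: real. \<forall>(V :: nat set) E (M :: (nat set \<Rightarrow> real) measure) w e f.
        simple_graph V E \<and> graph_connected V E \<and>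
        indep_edge_weights M E w \<and> atomless_edge_weights M E w \<and>
        e \<in> E \<and> f \<in> E \<and> e \<noteq> f \<longrightarrow>
        (let T = (\<lambda>\<omega>. mst V E (\<lambda>e'. w e' \<omega>)) in
         \<P>(\<omega> in M. e \<in> T \<omega> \<and> f \<in> T \<omega>)
           \<le> C * \<P>(\<omega> in M. e \<in> T \<omega>) * \<P>(\<omega> in M. f \<in> T \<omega>)))"
proof
  assume "\<exists>C :: real. \<forall>(V :: nat set) E (M :: (nat set \<Rightarrow> real) measure) w e f.
        simple_graph V E \<and> graph_connected V E \<and>
        indep_edge_weights M E w \<and> atomless_edge_weights M E w \<and>
        e \<in> E \<and> f \<in> E \<and> e \<noteq> f \<longrightarrow>
        (let T = (\<lambda>\<omega>. mst V E (\<lambda>e'. w e' \<omega>)) in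
         \<P>(\<omega> in M. e \<in> T \<omega> \<and> f \<in> T \<omega>)
           \<le> C * \<P>(\<omega> in M. e \<in> T \<omega>) * \<P>(\<omega> in M. f \<in> T \<omega>))"
  then obtain C :: real where C: "\<And>(V :: nat set) E (M :: (nat set \<Rightarrow> real) measure) w e f.
        simple_graph V E \<and> graph_connected V E \<and>
        indep_edge_weights M E w \<and> atomless_edge_weights M E w \<and>
        e \<in> E \<and> f \<in> E \<and> e \<noteq> f \<Longrightarrow>
        (let T = (\<lambda>\<omega>. mst V E (\<lambda>e'. w e' \<omega>)) in
         \<P>(\<omega> in M. e \<in> T \<omega> \<and> f \<in> T \<omega>)
           \<le> C * \<P>(\<omega> in M. e \<in> T \<omega>) * \<P>(\<omega> in M. f \<in> T \<omega>))"
    by meson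
  have "\<forall>\<^sub>F t in sequentially. C < R t \<and> t \<ge> 1"
    using R_at_top eventually_ge_at_top[of 1] by (auto simp: filterlim_at_top_dense intro: eventually_conj)
  then obtain t where "C < R t" and t: "t \<ge> 1"
    by (metis (no_types, lifting) eventually_sequentially order_refl)
  have "indep_edge_weights (K4_space t) K4_E (\<lambda>e \<omega>. \<omega> e)"
    using K4_weights_coordinates[OF t] by (simp add: K4_weights_def)
  moreover have "ab \<in> K4_E" "cd \<in> K4_E" "ab \<noteq> cd"
    by (simp_all add: K4_E_eq ab_def cd_def doubleton_eq_iff)
  ultimately have le: "\<P>(\<omega> in K4_space t. ab \<in> mst K4_V K4_E \<omega> \<and> cd \<in> mst K4_V K4_E \<omega>)
      \<le> C * \<P>(\<omega> in K4_space t. ab \<in> mst K4_V K4_E \<omega>) * \<P>(\<omega> in K4_space t. cd \<in> mst K4_V K4_E \<omega>)"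
    using C[of K4_V K4_E "K4_space t" "\<lambda>e \<omega>. \<omega> e" ab cd]
    by (simp add: simple_graph_K4 graph_connected_K4 K4_atomless[OF t] Let_def)
  \<comment> \<open>Positivity of the single probabilities turns the product inequality into a bound
    on the quotient \<open>R t\<close>.\<close>
  have "\<P>(\<omega> in K4_space t. ab \<in> mst K4_V K4_E \<omega>) > 0" "\<P>(\<omega> in K4_space t. cd \<in> mst K4_V K4_E \<omega>) > 0"
    unfolding K4_prob_ab[OF t] K4_prob_cd[OF t]
    using K4_denominator_pos[of "real t"] by (auto intro!: divide_pos_pos mult_pos_pos)
  then have "R t \<le> C"
    using le unfolding R_def mst_ratio_def Let_def by (simp add: pos_divide_le_eq mult.assoc)
  then show False using \<open>C < R t\<close> by simp
qed

text \<open>The first two conjuncts confirm that \<open>power_law\<close> and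
  \<open>K4_space\<close> are the intended objects. The third shows that the ratio is the same for
  every realization, so that it may be computed on \<open>K4_space\<close>.\<close>

theorem theoremC:
  shows
    "(\<forall>t\<ge>1. distr (PiM {..<t} (\<lambda>_. unif01)) borel (\<lambda>x. Max (x ` {..<t})) = power_law t) \<and>
     (\<forall>t\<ge>1. K4_weights t (K4_space t) (\<lambda>e \<omega>. \<omega> e)) \<and>
     (\<forall>t\<ge>1. \<forall>(M :: 'w measure) w. K4_weights t M w \<longrightarrow>
        (AE \<omega> in M. \<exists>!T. is_mst K4_V K4_E (\<lambda>e. w e \<omega>) T) \<and>
        mst_ratio K4_V K4_E M w ab cd = R t) \<and>
     (\<forall>t\<ge>1. AE \<omega> in K4_space t. \<exists>!T. is_mst K4_V K4_E \<omega> T) \<and>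
     (\<forall>t\<ge>1. R t = 2 * (5 * real t + 6) * (real t + 1) * (real t + 4)\<^sup>2 * (2 * real t + 3)
                   / (9 * (5 * (real t)\<^sup>2 + 12 * real t + 8)\<^sup>2)) \<and>
     (\<lambda>t. R t - (4 * real t / 45 + 46 / 75)) \<in> O(\<lambda>t. 1 / real t) \<and>
     strict_mono_on {1..} R \<and>
     R 84 > 8 \<and> (\<forall>t\<in>{1..<84}. R t \<le> 8) \<and>
     filterlim R at_top sequentially \<and>
     \<not> (\<exists>C :: real. \<forall>(V :: nat set) E (M :: (nat set \<Rightarrow> real) measure) w e f.
          simple_graph V E \<and> graph_connected V E \<and>
          indep_edge_weights M E w \<and> atomless_edge_weights M E w \<and>
          e \<in> E \<and> f \<in> E \<and> e \<noteq> f \<longrightarrow>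
          (let T = (\<lambda>\<omega>. mst V E (\<lambda>e'. w e' \<omega>)) in
           \<P>(\<omega> in M. e \<in> T \<omega> \<and> f \<in> T \<omega>)
             \<le> C * \<P>(\<omega> in M. e \<in> T \<omega>) * \<P>(\<omega> in M. f \<in> T \<omega>)))"
proof (intro conjI)
  show "\<forall>t\<ge>1. distr (PiM {..<t} (\<lambda>_. unif01)) borel (\<lambda>x. Max (x ` {..<t})) = power_law t"
    using distr_Max_unif01 by blast
  show "\<forall>t\<ge>1. K4_weights t (K4_space t) (\<lambda>e \<omega>. \<omega> e)"
    using K4_weights_coordinates by blast
  show "\<forall>t\<ge>1. \<forall>(M :: 'w measure) w. K4_weights t M w \<longrightarrow>
      (AE \<omega> in M. \<exists>!T. is_mst K4_V K4_E (\<lambda>e. w e \<omega>) T) \<and> mst_ratio K4_V K4_E M w ab cd = R t"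
  proof (intro allI impI conjI)
    fix t and M :: "'w measure" and w
    assume t: "t \<ge> 1" and w: "K4_weights t M w"
    show "AE \<omega> in M. \<exists>!T. is_mst K4_V K4_E (\<lambda>e. w e \<omega>) T"
      using t w by (rule K4_weights_AE_ex1_mst)
    show "mst_ratio K4_V K4_E M w ab cd = R t"
      unfolding R_def mst_ratio_def Let_def
      using K4_weights_prob_mst[OF t w, of "\<lambda>T. ab \<in> T \<and> cd \<in> T"]
        K4_weights_prob_mst[OF t w, of "\<lambda>T. ab \<in> T"] K4_weights_prob_mst[OF t w, of "\<lambda>T. cd \<in> T"]
      by simp
  qed
  show "\<forall>t\<ge>1. AE \<omega> in K4_space t. \<exists>!T. is_mst K4_V K4_E \<omega> T"
    using AE_K4_space_ex1_mst by blast
  show "\<forall>t\<ge>1. R t = 2 * (5 * real t + 6) * (real t + 1) * (real t + 4)\<^sup>2 * (2 * real t + 3)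
      / (9 * (5 * (real t)\<^sup>2 + 12 * real t + 8)\<^sup>2)"
    using R_eq by blast
  show "R 84 > 8" by (simp add: R_eq)
qed (intro R_asymptotics strict_mono_on_R R_at_top mst_ratio_unbounded ballI R_le_8; assumption)+

end
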